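(* For all $\gamma\in(0,1]$ and all natural numbers $k,q,r$ with $2\le r<q$ there exists $n_0$ such that for all $n\ge n_0$ there exists a weakly $k$-sparse partial $(n,q,r)$-Steiner system $\mathcal{S}$ on $n$ vertices with $|\mathcal{S}|\ge (1-\gamma)\binom{n}{r}/\binom{q}{r}$.
   Context: For $n\ge q>r\ge 2$, a partial $(n,q,r)$-Steiner system is a set $\mathcal{S}$ of $q$-subsets of some $n$-set $V$ such that every $r$-subset of $V$ is contained in at most one $q$-set in $\mathcal{S}$. A $(j,\ell)_{q,r}$-configuration is a set of $\ell$ $q$-sets on $j$ points (some of which may be isolated, i.e. lie in none of the $q$-sets) every two of which intersect in at most $r-1$ points. Define $\kappa_{q,r}(j):=\left\lfloor \frac{j-r-1}{q-r}\right\rfloor$. A (partial) $(n,q,r)$-Steiner system $\mathcal{S}$ is weakly $k$-sparse if there is no $(j,\kappa_{q,r}(j)+2)_{q,r}$-configuration in $\mathcal{S}$ with $j\ge q+1$ and $\kappa_{q,r}(j)+2\le k$. *)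

theory Defs
  imports Complex_Main "HOL-Library.Ramsey"
begin

definition partial_Steiner_system ::
    "nat \<Rightarrow> nat \<Rightarrow> nat \<Rightarrow> 'a set \<Rightarrow> 'a set set \<Rightarrow> bool" where
  "partial_Steiner_system n q r V S \<longleftrightarrow>
     2 \<le> r \<and> r < q \<and> q \<le> n \<and>
     finite V \<and> card V = n \<and> S \<subseteq> nsets V q \<and>
     (\<forall>T \<in> nsets V r. \<exists>\<^sub>\<le>\<^sub>1 Q. Q \<in> S \<and> T \<subseteq> Q)"

(* P is the set of points of the configuration; it may contain points
   that lie in no member of C. *)
definition configuration ::
    "nat \<Rightarrow> nat \<Rightarrow> nat \<Rightarrow> nat \<Rightarrow> 'a set \<Rightarrow> 'a set set \<Rightarrow> bool" where
  "configuration q r j l P C \<longleftrightarrow>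
     finite P \<and> card P = j \<and>
     C \<subseteq> nsets P q \<and> finite C \<and> card C = l \<and>
     pairwise (\<lambda>A B. card (A \<inter> B) \<le> r - 1) C"

definition kappa :: "nat \<Rightarrow> nat \<Rightarrow> nat \<Rightarrow> int" where
  "kappa q r j = \<lfloor>(real j - real r - 1) / (real q - real r)\<rfloor>"

(* "A configuration in S" is a subfamily of S together with a set of points
   of V, the vertex set of S; so isolated points are also taken from V. *)
definition weakly_sparse ::
    "nat \<Rightarrow> nat \<Rightarrow> nat \<Rightarrow> 'a set \<Rightarrow> 'a set set \<Rightarrow> bool" where
  "weakly_sparse k q r V S \<longleftrightarrow>
     \<not> (\<exists>j l P C. q + 1 \<le> j \<and> int l = kappa q r j + 2 \<and> l \<le> k \<and>
          P \<subseteq> V \<and> C \<subseteq> S \<and> configuration q r j l P C)"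

end

theory Submission
  imports Defs
begin

text \<open>
  A random greedy process in a bounded number of rounds covers almost all \<open>r\<close>-sets and contains few
  forbidden configurations; one block is then deleted from each of these.

  Let \<open>p = 1 / n ^ (q - r)\<close>. In each round every \<open>q\<close>-set is selected independently with probability
  \<open>p\<close>, the selected sets that share at least \<open>r\<close> points with another selected set are dropped, and
  the remaining packing \<open>M\<close> is the proposal. A proposed block is accepted if none of its \<open>r\<close>-subsets
  is covered so far.

  Coverage. The key claim (\<open>free_prob_approx\<close>) is that for every fixed number of rounds \<open>i\<close> and
  every set \<open>F\<close> of \<open>v\<close> distinct \<open>r\<close>-sets, whatever their position, the probability that all members
  of \<open>F\<close> are uncovered after \<open>i\<close> rounds is \<open>f i ^ v + O(1 / n)\<close>, where \<open>f 0 = 1\<close> and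
  \<open>f (i + 1) = f i - \<rho> * f i ^ K\<close> with \<open>K = q choose r\<close> and \<open>\<rho>\<close> the probability that a given \<open>r\<close>-set
  is covered by a proposal. Since \<open>M\<close> is a packing that is independent of the past,
  inclusion-exclusion expresses the probability for \<open>F\<close> after \<open>i + 1\<close> rounds as a linear combination
  of the probabilities after \<open>i\<close> rounds for \<open>F\<close> together with all \<open>r\<close>-subsets of some blocks \<open>g s\<close>,
  one through each \<open>s\<close> in a subset \<open>A\<close> of \<open>F\<close> (\<open>free_prob_Suc\<close>). Except for choices of total weight
  \<open>O(1 / n)\<close> (\<open>sum_clash_match_prob_le\<close>, \<open>card_clash_le\<close>), the blocks have no unforced common points,
  so that the enlarged set has exactly \<open>v + card A * (K - 1)\<close> members and the blocks are proposed almost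
  independently (\<open>match_prob_approx\<close>). The induction hypothesis then yields the expansion of
  \<open>(f i - \<rho> * f i ^ K) ^ v\<close>. No concentration inequality is needed, as the recursion is linear. As \<open>\<rho>\<close>
  is bounded away from 0, \<open>f\<close> falls below \<open>\<gamma> / 2\<close> after a number of rounds independent of \<open>n\<close>.

  Sparseness. A forbidden configuration consists of \<open>l\<close> blocks on at most \<open>(l - 1) * (q - r) + r\<close>
  points. A given set of \<open>l\<close> blocks is accepted with probability \<open>O(p ^ l)\<close> (\<open>joint_prob_le\<close>), so the
  expected number of these configurations is \<open>O(n ^ r / n ^ (q - r))\<close>, which is \<open>O(n ^ (r - 1))\<close> and
  hence negligible against \<open>n choose r\<close> (\<open>expected_dense_fams_le\<close>).
\<close>

section \<open>Binomial random subsets of a finite set\<close>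

text \<open>The expectation of \<open>g R\<close>, where the random set \<open>R\<close> contains each element of the finite set
  \<open>Q\<close> independently with probability \<open>p\<close>.\<close>
definition bexp :: "real \<Rightarrow> 'e set \<Rightarrow> ('e set \<Rightarrow> real) \<Rightarrow> real" where
  "bexp p Q g = (\<Sum>R\<in>Pow Q. p ^ card R * (1 - p) ^ card (Q - R) * g R)"

lemma bexp_sum:
  "bexp p Q (\<lambda>R. \<Sum>x\<in>X. c x * g x R) = (\<Sum>x\<in>X. c x * bexp p Q (g x))"
proof -
  have "bexp p Q (\<lambda>R. \<Sum>x\<in>X. c x * g x R) =
      (\<Sum>R\<in>Pow Q. \<Sum>x\<in>X. c x * (p ^ card R * (1 - p) ^ card (Q - R) * g x R))"
    unfolding bexp_def by (simp add: sum_distrib_left mult_ac)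
  also have "\<dots> = (\<Sum>x\<in>X. c x * bexp p Q (g x))"
    unfolding bexp_def by (subst sum.swap) (simp add: sum_distrib_left)
  finally show ?thesis .
qed

lemma bexp_mono:
  assumes "0 \<le> p" "p \<le> 1" "\<And>R. R \<subseteq> Q \<Longrightarrow> g R \<le> h R"
  shows "bexp p Q g \<le> bexp p Q h"
  unfolding bexp_def using assms by (intro sum_mono mult_left_mono) auto

text \<open>The probability that \<open>R\<close> contains \<open>X\<close> and avoids \<open>Y\<close>.\<close>
lemma bexp_of_bool:
  assumes "finite Q" "X \<subseteq> Q" "Y \<subseteq> Q" "X \<inter> Y = {}"
  shows "bexp p Q (\<lambda>R. of_bool (X \<subseteq> R \<and> R \<inter> Y = {})) = p ^ card X * (1 - p) ^ card Y"
proof -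
  \<comment> \<open>Expanding the product of \<open>a e + b e\<close> over \<open>Q\<close> gives the expectation term by term.\<close>
  define a where "a = (\<lambda>e. if e \<in> Y then 0 else p)"
  define b where "b = (\<lambda>e. if e \<in> X then 0 else 1 - p)"
  have fin: "finite R" if "R \<subseteq> Q" for R using that assms(1) finite_subset by blast
  have pa: "(\<Prod>e\<in>R. a e) = p ^ card R * of_bool (R \<inter> Y = {})" if "R \<subseteq> Q" for R
  proof (cases "R \<inter> Y = {}")
    case True
    then have "(\<Prod>e\<in>R. a e) = (\<Prod>e\<in>R. p)" unfolding a_def by (intro prod.cong) auto
    then show ?thesis using True by simp
  next
    case False
    then have "(\<Prod>e\<in>R. a e) = 0" using fin[OF that] unfolding a_def by (auto simp: prod_zero_iff)
    then show ?thesis using False by simp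
  qed
  have pb: "(\<Prod>e\<in>Q - R. b e) = (1 - p) ^ card (Q - R) * of_bool (X \<subseteq> R)" for R
  proof (cases "X \<subseteq> R")
    case True
    then have "(\<Prod>e\<in>Q - R. b e) = (\<Prod>e\<in>Q - R. 1 - p)" unfolding b_def by (intro prod.cong) auto
    then show ?thesis using True by simp
  next
    case False
    then have "(\<Prod>e\<in>Q - R. b e) = 0"
      using assms(1,2) unfolding b_def by (auto simp: prod_zero_iff)
    then show ?thesis using False by simp
  qed
  have "bexp p Q (\<lambda>R. of_bool (X \<subseteq> R \<and> R \<inter> Y = {})) =
      (\<Sum>R\<in>Pow Q. (\<Prod>e\<in>R. a e) * (\<Prod>e\<in>Q - R. b e))"
    unfolding bexp_def by (intro sum.cong refl) (auto simp: pa pb of_bool_conj)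
  also have "\<dots> = (\<Prod>e\<in>Q. a e + b e)" using assms(1) by (simp add: prod_add)
  also have "\<dots> = (\<Prod>e\<in>X. a e + b e) * (\<Prod>e\<in>Y. a e + b e) * (\<Prod>e\<in>Q - (X \<union> Y). a e + b e)"
  proof -
    have "(\<Prod>e\<in>Q. a e + b e) = (\<Prod>e\<in>Q - (X \<union> Y). a e + b e) * (\<Prod>e\<in>X \<union> Y. a e + b e)"
      using assms by (intro prod.subset_diff) auto
    moreover have "(\<Prod>e\<in>X \<union> Y. a e + b e) = (\<Prod>e\<in>X. a e + b e) * (\<Prod>e\<in>Y. a e + b e)"
      using assms fin by (intro prod.union_disjoint) auto
    ultimately show ?thesis by simp
  qed
  also have "(\<Prod>e\<in>X. a e + b e) = (\<Prod>e\<in>X. p)"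
    using assms(4) unfolding a_def b_def by (intro prod.cong) auto
  also have "(\<Prod>e\<in>Y. a e + b e) = (\<Prod>e\<in>Y. 1 - p)"
    using assms(4) unfolding a_def b_def by (intro prod.cong) auto
  also have "(\<Prod>e\<in>Q - (X \<union> Y). a e + b e) = (\<Prod>e\<in>Q - (X \<union> Y). 1)"
    unfolding a_def b_def by (intro prod.cong) auto
  finally show ?thesis by simp
qed

lemma bexp_const:
  assumes "finite Q"
  shows "bexp p Q (\<lambda>R. c) = c"
proof -
  have "bexp p Q (\<lambda>R. 1) = 1" using bexp_of_bool[OF assms, of "{}" "{}" p] by simp
  then show ?thesis using bexp_sum[of p Q "\<lambda>_. c" "\<lambda>_ _. 1" "{()}"] by simp
qed

section \<open>Counting sets that contain a given set\<close>

lemma card_nsets: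
  assumes "finite A"
  shows "card (nsets A k) = card A choose k"
proof -
  have "nsets A k = {B. B \<subseteq> A \<and> card B = k}"
    using assms finite_subset by (auto simp: nsets_def)
  then show ?thesis using n_subsets[OF assms] by simp
qed

lemma card_supersets:
  assumes "finite V" "X \<subseteq> V" "card X \<le> q"
  shows "card {e \<in> nsets V q. X \<subseteq> e} = (card V - card X) choose (q - card X)"
proof -
  have fX: "finite X" using assms finite_subset by blast
  have "bij_betw (\<lambda>e. e - X) {e \<in> nsets V q. X \<subseteq> e} (nsets (V - X) (q - card X))"
    by (rule bij_betw_byWitness[where f' = "\<lambda>e. e \<union> X"])
      (use assms fX in \<open>auto simp: nsets_def card_Diff_subset card_Un_disjoint Diff_disjoint
        intro!: card_Un_disjoint[THEN trans]\<close>)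
  then have "card {e \<in> nsets V q. X \<subseteq> e} = card (nsets (V - X) (q - card X))"
    by (rule bij_betw_same_card)
  then show ?thesis using assms fX by (simp add: card_nsets card_Diff_subset)
qed

lemma card_supersets_le:
  assumes "finite V" "finite X" "card X \<le> q"
  shows "card {e \<in> nsets V q. X \<subseteq> e} \<le> card V ^ (q - card X)"
proof (cases "X \<subseteq> V")
  case True
  have "(card V - card X) choose (q - card X) \<le> (card V - card X) ^ (q - card X)"
    by (cases "q - card X \<le> card V - card X") (auto intro: binomial_le_pow simp: binomial_eq_0)
  also have "\<dots> \<le> card V ^ (q - card X)"
    by (rule power_mono) auto
  finally show ?thesis using card_supersets[OF assms(1) True assms(3)] by simp
next
  case False
  then have "{e \<in> nsets V q. X \<subseteq> e} = {}" by (auto simp: nsets_def)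
  then show ?thesis by (simp only: card.empty)
qed

lemma ex_bij_mapping_subset:
  assumes "finite V" "e \<subseteq> V" "e' \<subseteq> V" "card e = card e'"
  shows "\<exists>h. bij_betw h V V \<and> h ` e = e'"
proof -
  have f: "finite e" "finite e'" using assms finite_subset by blast+
  obtain h1 where h1: "bij_betw h1 e e'" using f assms(4) finite_same_card_bij by blast
  obtain h2 where h2: "bij_betw h2 (V - e) (V - e')"
    using finite_same_card_bij[of "V - e" "V - e'"] assms f by (auto simp: card_Diff_subset)
  define h where "h = (\<lambda>x. if x \<in> e then h1 x else h2 x)"
  have "bij_betw h e e'" using h1 by (rule bij_betw_cong[THEN iffD1, rotated]) (simp add: h_def)
  moreover have "bij_betw h (V - e) (V - e')"
    using h2 by (rule bij_betw_cong[THEN iffD1, rotated]) (simp add: h_def)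
  ultimately have "bij_betw h (e \<union> (V - e)) (e' \<union> (V - e'))"
    by (rule bij_betw_combine) auto
  then have "bij_betw h V V" using assms by (simp add: Un_absorb1)
  with \<open>bij_betw h e e'\<close> show ?thesis by (auto simp: bij_betw_def)
qed

section \<open>The random greedy process in rounds\<close>

text \<open>Blocks are the \<open>q\<close>-subsets of the point set \<open>V\<close>; two blocks conflict if they share at least
  \<open>r\<close> points. The bound on \<open>card V\<close> makes blocks exist and keeps \<open>n - r\<close> at least \<open>n / 2\<close>.\<close>
locale greedy_rounds =
  fixes V :: "'a set" and q r :: nat
  assumes finV: "finite V" and r_pos: "1 \<le> r" and r_less: "r < q" and V_large: "2 * q \<le> card V"
begin

abbreviation n :: nat where "n \<equiv> card V"

abbreviation Q :: "'a set set" where "Q \<equiv> nsets V q"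

text \<open>The probability with which a block is selected in a round: the degree \<open>(n - r) choose (q - r)\<close>
  of an \<open>r\<close>-set times \<open>p\<close> is bounded above and away from 0.\<close>
definition p :: real where "p = 1 / real n ^ (q - r)"

text \<open>A packing is a partial Steiner system: distinct blocks share fewer than \<open>r\<close> points.\<close>
definition packing :: "'a set set \<Rightarrow> bool" where
  "packing S \<longleftrightarrow> S \<subseteq> Q \<and> pairwise (\<lambda>e f. card (e \<inter> f) < r) S"

text \<open>The members of \<open>R\<close> that conflict with no other member of \<open>R\<close>.\<close>
definition isolated :: "'a set set \<Rightarrow> 'a set set" where
  "isolated R = {e \<in> R. \<forall>f\<in>R. f \<noteq> e \<longrightarrow> card (e \<inter> f) < r}"

text \<open>Expectation over the random packing \<open>M\<close> of one round: the conflict-free blocks of a binomial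
  random set of blocks.\<close>
definition match_exp :: "('a set set \<Rightarrow> real) \<Rightarrow> real" where
  "match_exp g = bexp p Q (\<lambda>R. g (isolated R))"

text \<open>The \<open>r\<close>-sets covered by \<open>S\<close>.\<close>
definition shadow :: "'a set set \<Rightarrow> 'a set set" where
  "shadow S = (\<Union>e\<in>S. nsets e r)"

text \<open>From the proposal \<open>M\<close> accept the blocks none of whose \<open>r\<close>-subsets is already covered.\<close>
definition extend :: "'a set set \<Rightarrow> 'a set set \<Rightarrow> 'a set set" where
  "extend S M = S \<union> {e \<in> M. nsets e r \<inter> shadow S = {}}"

text \<open>The expectation of \<open>g S\<close>, where \<open>S\<close> is the packing reached from the empty one after the given
  number of independent rounds.\<close>
primrec rexp :: "nat \<Rightarrow> ('a set set \<Rightarrow> real) \<Rightarrow> real" where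
  "rexp 0 g = g {}"
| "rexp (Suc i) g = rexp i (\<lambda>S. match_exp (\<lambda>M. g (extend S M)))"

lemma QD: "e \<in> Q \<Longrightarrow> e \<subseteq> V \<and> finite e \<and> card e = q"
  by (auto simp: nsets_def)

lemma finQ: "finite Q"
  by (simp add: finV finite_imp_finite_nsets)

lemma n_ge: "4 \<le> n" "q \<le> n" "r < n"
  using r_pos r_less V_large by auto

lemma p_pos: "0 < p"
  using n_ge by (simp add: p_def)

lemma p_le_half: "p \<le> 1 / 2"
proof -
  have "(2::real) \<le> real n ^ 1" using n_ge by simp
  also have "\<dots> \<le> real n ^ (q - r)" using n_ge r_less by (intro power_increasing) auto
  finally have "2 \<le> real n ^ (q - r)" .
  then show ?thesis unfolding p_def using n_ge by (intro divide_left_mono) auto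
qed

lemma packingD:
  assumes "packing S" "e \<in> S" "f \<in> S" "T \<subseteq> e" "T \<subseteq> f" "r \<le> card T"
  shows "e = f"
proof (rule ccontr)
  assume "e \<noteq> f"
  then have "card (e \<inter> f) < r" using assms by (auto simp: packing_def pairwise_def)
  moreover have "card T \<le> card (e \<inter> f)"
    using assms QD by (intro card_mono) (auto simp: packing_def)
  ultimately show False using assms(6) by simp
qed

lemma packing_subset: "packing S \<Longrightarrow> S' \<subseteq> S \<Longrightarrow> packing S'"
  unfolding packing_def using pairwise_subset by blast

lemma packing_isolated: "R \<subseteq> Q \<Longrightarrow> packing (isolated R)"
  by (auto simp: packing_def pairwise_def isolated_def)

lemma packing_extend:
  assumes "packing S" "packing M"
  shows "packing (extend S M)"
proof -
  have key: "card (e \<inter> f) < r" if "e \<in> S" "f \<in> M" "nsets f r \<inter> shadow S = {}" for e f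
  proof (rule ccontr)
    assume "\<not> card (e \<inter> f) < r"
    then obtain T where "T \<subseteq> e \<inter> f" "card T = r" "finite T"
      using obtain_subset_with_card_n[of r "e \<inter> f"] by (metis not_less)
    then have "T \<in> nsets f r" "T \<in> nsets e r" by (auto simp: nsets_def)
    then show False using that by (auto simp: shadow_def)
  qed
  show ?thesis
    unfolding packing_def
  proof
    show "extend S M \<subseteq> Q" using assms by (auto simp: packing_def extend_def)
    show "pairwise (\<lambda>e f. card (e \<inter> f) < r) (extend S M)"
    proof (rule pairwiseI)
      fix e f assume ef: "e \<in> extend S M" "f \<in> extend S M" "e \<noteq> f"
      consider "e \<in> S" "f \<in> S" | "e \<in> M" "f \<in> M"
        | "e \<in> S" "f \<in> M" "nsets f r \<inter> shadow S = {}"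
        | "f \<in> S" "e \<in> M" "nsets e r \<inter> shadow S = {}"
        using ef by (auto simp: extend_def)
      then show "card (e \<inter> f) < r"
      proof cases
        case 4
        then show ?thesis using key[of f e] by (simp add: Int_commute)
      qed (use assms ef(3) key in \<open>auto simp: packing_def pairwise_def\<close>)
    qed
  qed
qed

lemma match_exp_mono:
  assumes "\<And>M. packing M \<Longrightarrow> g M \<le> h M"
  shows "match_exp g \<le> match_exp h"
  unfolding match_exp_def using p_pos p_le_half assms packing_isolated
  by (intro bexp_mono) auto

lemma match_exp_sum:
  "match_exp (\<lambda>M. \<Sum>x\<in>X. c x * g x M) = (\<Sum>x\<in>X. c x * match_exp (g x))"
  unfolding match_exp_def by (rule bexp_sum)

lemma match_exp_const: "match_exp (\<lambda>M. c) = c"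
  unfolding match_exp_def by (rule bexp_const[OF finQ])

lemma rexp_mono:
  assumes "\<And>S. packing S \<Longrightarrow> g S \<le> h S"
  shows "rexp i g \<le> rexp i h"
  using assms
proof (induction i arbitrary: g h)
  case 0
  then show ?case by (simp add: packing_def)
next
  case (Suc i)
  show ?case by (simp, intro Suc.IH match_exp_mono Suc.prems packing_extend)
qed

lemma rexp_sum:
  "rexp i (\<lambda>S. \<Sum>x\<in>X. c x * g x S) = (\<Sum>x\<in>X. c x * rexp i (g x))"
  by (induction i arbitrary: g) (simp_all add: match_exp_sum)

lemma rexp_cmult: "rexp i (\<lambda>S. c * g S) = c * rexp i g"
  using rexp_sum[of i "\<lambda>_. c" "\<lambda>_. g" "{()}"] by simp

lemma rexp_const: "rexp i (\<lambda>S. c) = c"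
  by (induction i) (simp_all add: match_exp_const)

lemma ex_packing_le_rexp: "\<exists>S. packing S \<and> g S \<le> rexp i g"
proof (rule ccontr)
  assume no: "\<not> ?thesis"
  \<comment> \<open>There are finitely many packings, so \<open>g\<close> attains its minimum on them.\<close>
  define P where "P = {S. packing S}"
  have "P \<subseteq> Pow Q" by (auto simp: P_def packing_def)
  then have "finite P" using finQ finite_subset by blast
  moreover have "{} \<in> P" by (simp add: P_def packing_def)
  ultimately have "Min (g ` P) \<in> g ` P" by (intro Min_in) auto
  then obtain S0 where S0: "S0 \<in> P" "g S0 = Min (g ` P)" by auto
  have "g S0 \<le> g S" if "packing S" for S
    using \<open>finite P\<close> that S0(2) by (simp add: P_def)
  then have "g S0 \<le> rexp i g" using rexp_mono[of "\<lambda>_. g S0" g i] by (simp add: rexp_const)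
  with no S0(1) show False by (auto simp: P_def)
qed

section \<open>The proposal of one round\<close>

text \<open>The probability that all blocks of \<open>E\<close> belong to the proposal of a round.\<close>
definition match_prob :: "'a set set \<Rightarrow> real" where
  "match_prob E = match_exp (\<lambda>M. of_bool (E \<subseteq> M))"

lemma match_prob_nonneg: "0 \<le> match_prob E"
  using match_exp_mono[of "\<lambda>_. 0" "\<lambda>M. of_bool (E \<subseteq> M)"]
  by (simp add: match_prob_def match_exp_const)

lemma match_prob_le: "match_prob E \<le> p ^ card E"
proof (cases "E \<subseteq> Q")
  case True
  have "match_prob E \<le> bexp p Q (\<lambda>R. of_bool (E \<subseteq> R \<and> R \<inter> {} = {}))"
    unfolding match_prob_def match_exp_def using p_pos p_le_half
    by (intro bexp_mono) (auto simp: isolated_def)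
  also have "\<dots> = p ^ card E" using True by (subst bexp_of_bool) (auto simp: finQ)
  finally show ?thesis .
next
  case False
  then have "match_prob E \<le> match_exp (\<lambda>M. 0)"
    unfolding match_prob_def by (intro match_exp_mono) (auto simp: packing_def)
  also have "\<dots> \<le> p ^ card E" using p_pos by (simp add: match_exp_const)
  finally show ?thesis .
qed

text \<open>The blocks in conflict with \<open>e\<close>.\<close>
definition nbr :: "'a set \<Rightarrow> 'a set set" where
  "nbr e = {f \<in> Q. f \<noteq> e \<and> r \<le> card (e \<inter> f)}"

lemma match_prob_eq:
  assumes "packing E"
  shows "match_prob E = p ^ card E * (1 - p) ^ card (\<Union>e\<in>E. nbr e)"
proof -
  have E: "E \<subseteq> Q" using assms by (simp add: packing_def)
  have d: "E \<inter> (\<Union>e\<in>E. nbr e) = {}"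
  proof -
    have "f \<notin> nbr e" if "e \<in> E" "f \<in> E" for e f
    proof
      assume "f \<in> nbr e"
      moreover from this have "e \<noteq> f" by (auto simp: nbr_def)
      then have "card (e \<inter> f) < r"
        using assms that unfolding packing_def by (meson pairwiseD)
      ultimately show False by (simp add: nbr_def)
    qed
    then show ?thesis by blast
  qed
  have "E \<subseteq> isolated R \<longleftrightarrow> E \<subseteq> R \<and> R \<inter> (\<Union>e\<in>E. nbr e) = {}" if "R \<subseteq> Q" for R
  proof
    assume l: "E \<subseteq> isolated R"
    have "f \<notin> nbr e" if "f \<in> R" "e \<in> E" for e f
    proof
      assume "f \<in> nbr e"
      moreover have "e \<in> isolated R" using l that by blast
      ultimately show False using \<open>f \<in> R\<close> by (auto simp: isolated_def nbr_def)
    qed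
    with l show "E \<subseteq> R \<and> R \<inter> (\<Union>e\<in>E. nbr e) = {}" by (auto simp: isolated_def)
  next
    assume a: "E \<subseteq> R \<and> R \<inter> (\<Union>e\<in>E. nbr e) = {}"
    show "E \<subseteq> isolated R"
    proof
      fix e assume e: "e \<in> E"
      have "card (e \<inter> f) < r" if f: "f \<in> R" "f \<noteq> e" for f
      proof -
        have "f \<notin> nbr e" "f \<in> Q" using a e f \<open>R \<subseteq> Q\<close> by auto
        then show ?thesis using f by (simp add: nbr_def)
      qed
      then show "e \<in> isolated R" using a e by (auto simp: isolated_def)
    qed
  qed
  then have "match_prob E = bexp p Q (\<lambda>R. of_bool (E \<subseteq> R \<and> R \<inter> (\<Union>e\<in>E. nbr e) = {}))"
    unfolding match_prob_def match_exp_def bexp_def by (intro sum.cong refl) auto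
  also have "\<dots> = p ^ card E * (1 - p) ^ card (\<Union>e\<in>E. nbr e)"
    using E d by (intro bexp_of_bool finQ) (auto simp: nbr_def)
  finally show ?thesis .
qed

lemma card_nbr_eq:
  assumes "e \<in> Q" "e' \<in> Q"
  shows "card (nbr e) = card (nbr e')"
proof -
  obtain h where h: "bij_betw h V V" "h ` e = e'"
    using ex_bij_mapping_subset[OF finV, of e e'] assms QD by metis
  have inj: "inj_on h V" using h by (simp add: bij_betw_def)
  have b: "bij_betw ((`) h) Q Q" using h(1) by (rule bij_betw_nsets)
  have pres: "h ` f \<in> nbr e' \<longleftrightarrow> f \<in> nbr e" if f: "f \<in> Q" for f
  proof -
    have fs: "f \<subseteq> V" "e \<subseteq> V" using f assms QD by auto
    have "h ` f \<in> Q" using b f by (auto simp: bij_betw_def)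
    moreover have "h ` f = e' \<longleftrightarrow> f = e"
      using inj_on_image_eq_iff[OF inj fs] h(2) by simp
    moreover have "e' \<inter> h ` f = h ` (e \<inter> f)"
      using inj_on_image_Int[OF inj fs(2) fs(1)] h(2) by simp
    moreover have "card (h ` (e \<inter> f)) = card (e \<inter> f)"
      using inj fs by (intro card_image) (auto intro: inj_on_subset)
    ultimately show ?thesis using f by (simp add: nbr_def)
  qed
  have "bij_betw ((`) h) (nbr e) (nbr e')"
    unfolding bij_betw_def
  proof
    show "inj_on ((`) h) (nbr e)" using b
      by (auto simp: bij_betw_def nbr_def intro: inj_on_subset)
    show "(`) h ` nbr e = nbr e'"
    proof
      show "(`) h ` nbr e \<subseteq> nbr e'" using pres by (auto simp: nbr_def)
      show "nbr e' \<subseteq> (`) h ` nbr e"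
      proof
        fix f' assume f': "f' \<in> nbr e'"
        then have "f' \<in> Q" by (simp add: nbr_def)
        then have "f' \<in> (`) h ` Q" using b by (simp add: bij_betw_def)
          then obtain f where "f \<in> Q" "f' = h ` f" by blast
        then show "f' \<in> (`) h ` nbr e" using pres f' by auto
      qed
    qed
  qed
  then show ?thesis by (rule bij_betw_same_card)
qed

text \<open>The number of conflicts of a block, which is the same for all blocks.\<close>
definition num_nbrs :: nat where "num_nbrs = card (nbr (SOME e. e \<in> Q))"

lemma card_nbr: "e \<in> Q \<Longrightarrow> card (nbr e) = num_nbrs"
  unfolding num_nbrs_def by (rule card_nbr_eq) (auto intro: someI)

lemma card_containing_le:
  assumes "finite X" "card X \<le> q"
  shows "card {e \<in> Q. X \<subseteq> e} \<le> n ^ (q - card X)"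
  using card_supersets_le[OF finV assms] .

lemma card_meeting_le:
  assumes "finite W" "t \<le> q"
  shows "card {f \<in> Q. t \<le> card (W \<inter> f)} \<le> (card W choose t) * n ^ (q - t)"
proof -
  have "{f \<in> Q. t \<le> card (W \<inter> f)} \<subseteq> (\<Union>X\<in>nsets W t. {f \<in> Q. X \<subseteq> f})"
  proof
    fix f assume "f \<in> {f \<in> Q. t \<le> card (W \<inter> f)}"
    then obtain X where "X \<subseteq> W \<inter> f" "card X = t" "finite X" "f \<in> Q"
      using obtain_subset_with_card_n[of t "W \<inter> f"] by auto
    then show "f \<in> (\<Union>X\<in>nsets W t. {f \<in> Q. X \<subseteq> f})" by (auto simp: nsets_def)
  qed
  then have "card {f \<in> Q. t \<le> card (W \<inter> f)} \<le> card (\<Union>X\<in>nsets W t. {f \<in> Q. X \<subseteq> f})"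
    using finQ assms by (intro card_mono finite_UN_I finite_imp_finite_nsets) auto
  also have "\<dots> \<le> (\<Sum>X\<in>nsets W t. card {f \<in> Q. X \<subseteq> f})"
    using assms by (intro card_UN_le finite_imp_finite_nsets)
  also have "\<dots> \<le> (\<Sum>X\<in>nsets W t. n ^ (q - t))"
  proof (rule sum_mono)
    fix X assume "X \<in> nsets W t"
    then have "finite X" "card X = t" by (auto simp: nsets_def)
    then show "card {f \<in> Q. X \<subseteq> f} \<le> n ^ (q - t)"
      using card_containing_le[of X] assms by auto
  qed
  finally show ?thesis using assms by (simp add: card_nsets)
qed

lemma num_nbrs_le: "num_nbrs \<le> (q choose r) * n ^ (q - r)"
proof -
  obtain e where e: "e \<in> Q"
    using n_ge finV nsets_eq_empty_iff[of V q] by (metis ex_in_conv not_less)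
  have "card (nbr e) \<le> card {f \<in> Q. r \<le> card (e \<inter> f)}"
    using finQ by (intro card_mono) (auto simp: nbr_def)
  also have "\<dots> \<le> (card e choose r) * n ^ (q - r)"
    using QD[OF e] r_less by (intro card_meeting_le) auto
  finally show ?thesis using card_nbr[OF e] QD[OF e] by simp
qed

text \<open>A common conflict of two compatible blocks meets their union in more than \<open>r\<close> points, since
  otherwise both blocks would contain the same \<open>r\<close> points of it.\<close>
lemma card_common_nbrs_le:
  assumes "e \<in> Q" "e' \<in> Q" "card (e \<inter> e') < r"
  shows "card (nbr e \<inter> nbr e') \<le> 4 ^ q * n ^ (q - r - 1)"
proof -
  have fin: "finite e" "finite e'" using assms QD by auto
  have "nbr e \<inter> nbr e' \<subseteq> {f \<in> Q. r + 1 \<le> card ((e \<union> e') \<inter> f)}"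
  proof
    fix f assume f: "f \<in> nbr e \<inter> nbr e'"
    have fr: "r \<le> card (e \<inter> f)" "r \<le> card (e' \<inter> f)" using f by (auto simp: nbr_def)
    have "r + 1 \<le> card ((e \<union> e') \<inter> f)"
    proof (rule ccontr)
      assume "\<not> ?thesis"
      then have le: "card ((e \<union> e') \<inter> f) \<le> r" by simp
      have "e \<inter> f = (e \<union> e') \<inter> f" using le fr fin by (intro card_seteq) auto
      moreover have "e' \<inter> f = (e \<union> e') \<inter> f" using le fr fin by (intro card_seteq) auto
      ultimately have "e \<inter> f \<subseteq> e \<inter> e'" by blast
      then have "card (e \<inter> f) \<le> card (e \<inter> e')" using fin by (intro card_mono) auto
      then show False using fr assms(3) by simp
    qed
    then show "f \<in> {f \<in> Q. r + 1 \<le> card ((e \<union> e') \<inter> f)}" using f by (simp add: nbr_def)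
  qed
  then have "card (nbr e \<inter> nbr e') \<le> card {f \<in> Q. r + 1 \<le> card ((e \<union> e') \<inter> f)}"
    using finQ by (intro card_mono) auto
  also have "\<dots> \<le> (card (e \<union> e') choose (r + 1)) * n ^ (q - (r + 1))"
    using fin r_less by (intro card_meeting_le) auto
  also have "\<dots> \<le> 2 ^ card (e \<union> e') * n ^ (q - (r + 1))"
    by (intro mult_right_mono binomial_le_pow2) auto
  also have "\<dots> \<le> 2 ^ (2 * q) * n ^ (q - (r + 1))"
  proof -
    have "card (e \<union> e') \<le> 2 * q" using card_Un_le[of e e'] QD assms by auto
    then show ?thesis by (intro mult_right_mono power_increasing) auto
  qed
  finally show ?thesis by (simp add: power_mult)
qed

lemma card_union_nbrs_ge:
  assumes "finite E" "packing E"
  shows "card E * num_nbrs \<le> card (\<Union>e\<in>E. nbr e) + (card E)\<^sup>2 * (4 ^ q * n ^ (q - r - 1))"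
  using assms
proof (induction E rule: finite_induct)
  case empty
  then show ?case by simp
next
  case (insert e E)
  let ?B = "4 ^ q * n ^ (q - r - 1)"
  let ?N = "\<Union>e\<in>E. nbr e"
  have eQ: "e \<in> Q" and EQ: "E \<subseteq> Q" using insert.prems by (auto simp: packing_def)
  have fn: "finite (nbr e)" for e using finQ by (simp add: nbr_def)
  have IH: "card E * num_nbrs \<le> card ?N + (card E)\<^sup>2 * ?B"
    using insert packing_subset[of "insert e E" E] by auto
  have "card (nbr e \<inter> ?N) \<le> card (\<Union>f\<in>E. nbr e \<inter> nbr f)"
    using fn insert.hyps by (intro card_mono) auto
  also have "\<dots> \<le> (\<Sum>f\<in>E. card (nbr e \<inter> nbr f))"
    using insert.hyps by (intro card_UN_le)
  also have "\<dots> \<le> (\<Sum>f\<in>E. ?B)"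
  proof (rule sum_mono)
    fix f assume "f \<in> E"
    then have "card (e \<inter> f) < r"
      using insert.prems insert.hyps by (auto simp: packing_def pairwise_def)
    then show "card (nbr e \<inter> nbr f) \<le> ?B"
      using card_common_nbrs_le[OF eQ, of f] EQ \<open>f \<in> E\<close> by blast
  qed
  finally have ov: "card (nbr e \<inter> ?N) \<le> card E * ?B" by simp
  have "num_nbrs + card ?N = card (nbr e \<union> ?N) + card (nbr e \<inter> ?N)"
    using card_Un_Int[of "nbr e" ?N] fn insert.hyps card_nbr[OF eQ] by simp
  then have "card (insert e E) * num_nbrs
      \<le> card (\<Union>e\<in>insert e E. nbr e) + (card E * ?B + (card E)\<^sup>2 * ?B)"
    using IH ov insert.hyps by simp
  also have "card E * ?B + (card E)\<^sup>2 * ?B \<le> (card (insert e E))\<^sup>2 * ?B"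
    using insert.hyps by (simp add: power2_eq_square algebra_simps)
  finally show ?case by simp
qed

text \<open>The probability that a given block belongs to the proposal.\<close>
definition edge_prob :: real where "edge_prob = p * (1 - p) ^ num_nbrs"

lemma edge_prob_bounds: "0 < edge_prob" "edge_prob \<le> p"
  using p_pos p_le_half by (auto simp: edge_prob_def mult_le_cancel_left1 power_le_one)

lemma p_mult_power: "p * real (n ^ (q - r - 1)) = 1 / real n"
proof -
  have "q - r = Suc (q - r - 1)" using r_less by simp
  then have "p = 1 / (real n * real n ^ (q - r - 1))" by (metis p_def power_Suc)
  then show ?thesis using n_ge by simp
qed

text \<open>Compatible blocks are proposed almost independently, because they have few common conflicts.\<close>
lemma match_prob_approx:
  assumes "finite E" "packing E"
  shows "\<bar>match_prob E - edge_prob ^ card E\<bar> \<le> p ^ card E * ((card E)\<^sup>2 * 4 ^ q / n)"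
proof -
  define N where "N = card (\<Union>e\<in>E. nbr e)"
  define d where "d = card E * num_nbrs - N"
  have ENle: "N \<le> card E * num_nbrs"
  proof -
    have "N \<le> (\<Sum>e\<in>E. card (nbr e))" unfolding N_def using assms by (intro card_UN_le)
    also have "\<dots> = (\<Sum>e\<in>E. num_nbrs)"
      using assms by (intro sum.cong card_nbr) (auto simp: packing_def)
    finally show ?thesis by simp
  qed
  then have ENd: "card E * num_nbrs = N + d" by (simp add: d_def)
  have dle: "d \<le> (card E)\<^sup>2 * (4 ^ q * n ^ (q - r - 1))"
    using card_union_nbrs_ge[OF assms] unfolding d_def N_def by simp
  have "edge_prob ^ card E = p ^ card E * (1 - p) ^ (card E * num_nbrs)"
    by (simp add: edge_prob_def power_mult_distrib mult.commute flip: power_mult)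
  also have "\<dots> = p ^ card E * ((1 - p) ^ N * (1 - p) ^ d)" by (simp add: ENd power_add)
  finally have "match_prob E - edge_prob ^ card E = p ^ card E * ((1 - p) ^ N * (1 - (1 - p) ^ d))"
    by (simp add: match_prob_eq[OF assms(2)] N_def algebra_simps)
  moreover have "0 \<le> (1 - p) ^ N * (1 - (1 - p) ^ d)"
    using p_pos p_le_half by (simp add: power_le_one)
  moreover have "(1 - p) ^ N * (1 - (1 - p) ^ d) \<le> 1 * (1 - (1 - p) ^ d)"
    using p_pos p_le_half by (intro mult_right_mono) (auto simp: power_le_one)
  moreover have "1 - (1 - p) ^ d \<le> d * p"
    using Bernoulli_inequality[of "- p" d] p_le_half by simp
  moreover have "d * p \<le> (card E)\<^sup>2 * 4 ^ q / n"
  proof -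
    have "real d * p \<le> real ((card E)\<^sup>2 * (4 ^ q * n ^ (q - r - 1))) * p"
      using dle p_pos by (intro mult_right_mono) (auto simp del: of_nat_mult of_nat_power)
    also have "\<dots> = (card E)\<^sup>2 * 4 ^ q * (p * real (n ^ (q - r - 1)))" by simp
    also have "\<dots> = (card E)\<^sup>2 * 4 ^ q / n" by (simp only: p_mult_power) simp
    finally show ?thesis .
  qed
  ultimately have "\<bar>match_prob E - edge_prob ^ card E\<bar> = p ^ card E * ((1 - p) ^ N * (1 - (1 - p) ^ d))"
    "(1 - p) ^ N * (1 - (1 - p) ^ d) \<le> (card E)\<^sup>2 * 4 ^ q / n"
    using p_pos by auto
  then show ?thesis using p_pos by (simp only:) (intro mult_left_mono, auto)
qed

end

lemma prod_of_bool:
  "finite A \<Longrightarrow> (\<Prod>x\<in>A. of_bool (P x)) = (of_bool (\<forall>x\<in>A. P x) :: 'b :: comm_semiring_1)"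
  by (induction A rule: finite_induct) auto

context greedy_rounds
begin

section \<open>A linear recursion for the probability of being uncovered\<close>

text \<open>The blocks that contain \<open>s\<close>; there are \<open>deg\<close> of them if \<open>s\<close> is an \<open>r\<close>-set.\<close>
definition star :: "'a set \<Rightarrow> 'a set set" where "star s = {e \<in> Q. s \<subseteq> e}"

definition deg :: nat where "deg = (n - r) choose (q - r)"

lemma finite_star: "finite (star s)"
  using finQ by (simp add: star_def)

lemma rsetD: "s \<in> nsets V r \<Longrightarrow> s \<subseteq> V \<and> finite s \<and> card s = r"
  by (auto simp: nsets_def)

lemma card_star: "s \<in> nsets V r \<Longrightarrow> card (star s) = deg"
  unfolding star_def deg_def using card_supersets[OF finV, of s q] rsetD[of s] r_less by simp

lemma deg_p_le: "real deg * p \<le> 1"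
proof -
  have "deg \<le> (n - r) ^ (q - r)" unfolding deg_def
    using V_large by (intro binomial_le_pow) auto
  also have "\<dots> \<le> n ^ (q - r)" by (intro power_mono) auto
  finally have "real deg \<le> real n ^ (q - r)" using of_nat_mono by fastforce
  then show ?thesis using n_ge by (simp add: p_def divide_simps)
qed

lemma shadow_extend:
  "shadow (extend S M) = shadow S \<union> shadow {e \<in> M. nsets e r \<inter> shadow S = {}}"
  by (auto simp: shadow_def extend_def)

text \<open>Indicator of the event that \<open>S\<close> covers no member of \<open>F\<close>.\<close>
definition unc :: "'a set set \<Rightarrow> 'a set set \<Rightarrow> real" where
  "unc F S = of_bool (F \<inter> shadow S = {})"

lemma unc_Un: "unc (F \<union> F') S = unc F S * unc F' S"
  by (auto simp: unc_def)

lemma unc_UN: "finite A \<Longrightarrow> unc (\<Union>s\<in>A. B s) S = (\<Prod>s\<in>A. unc (B s) S)"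
  unfolding unc_def by (subst prod_of_bool) (auto simp: of_bool_def)

text \<open>As \<open>M\<close> is a packing, at most one block of \<open>M\<close> contains \<open>s\<close>; hence the indicator that \<open>s\<close>
  becomes covered in this round is a plain sum over the blocks through \<open>s\<close>.\<close>
lemma cover_sum:
  assumes M: "packing M" and s: "s \<in> nsets V r"
  shows "(\<Sum>e\<in>star s. of_bool (e \<in> M) * unc (nsets e r) S) =
    of_bool (s \<in> shadow {e \<in> M. nsets e r \<inter> shadow S = {}})"
proof (cases "\<exists>e\<in>M. s \<in> nsets e r \<and> nsets e r \<inter> shadow S = {}")
  case True
  then obtain e0 where e0: "e0 \<in> M" "s \<subseteq> e0" "nsets e0 r \<inter> shadow S = {}"
    by (auto simp: nsets_def)
  then have "e0 \<in> star s" using M by (auto simp: star_def packing_def)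
  have "e = e0" if "e \<in> M" "e \<in> star s" for e
    using packingD[OF M that(1) e0(1), of s] that(2) e0(2) rsetD[OF s] by (simp add: star_def)
  then have "(\<Sum>e\<in>star s. of_bool (e \<in> M) * unc (nsets e r) S) =
      (\<Sum>e\<in>star s. if e = e0 then 1 else 0)"
    using e0 by (intro sum.cong refl) (auto simp: unc_def)
  then show ?thesis using True \<open>e0 \<in> star s\<close> finite_star by (auto simp: shadow_def)
next
  case False
  have "of_bool (e \<in> M) * unc (nsets e r) S = 0" if "e \<in> star s" for e
    using False that rsetD[OF s] by (auto simp: star_def unc_def nsets_def)
  then have "(\<Sum>e\<in>star s. of_bool (e \<in> M) * unc (nsets e r) S) = 0"
    by (intro sum.neutral) blast
  with False show ?thesis by (auto simp: shadow_def)
qed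

text \<open>Inclusion-exclusion over the set \<open>A\<close> of members of \<open>F\<close> that become covered; the function \<open>g\<close>
  names the covering blocks.\<close>
lemma unc_extend:
  assumes M: "packing M" and F: "finite F" "F \<subseteq> nsets V r"
  shows "unc F (extend S M) = (\<Sum>A\<in>Pow F. (-1) ^ card A * (\<Sum>g\<in>PiE A star.
    unc (F \<union> (\<Union>s\<in>A. nsets (g s) r)) S * of_bool (g ` A \<subseteq> M)))"
proof -
  define cov where "cov s = (\<Sum>e\<in>star s. of_bool (e \<in> M) * unc (nsets e r) S)" for s
  have "unc F (extend S M) = unc F S * (\<Prod>s\<in>F. of_bool (s \<notin> shadow {e \<in> M. nsets e r \<inter> shadow S = {}}))"
    using F(1) by (subst prod_of_bool) (auto simp: unc_def shadow_extend)
  also have "(\<Prod>s\<in>F. of_bool (s \<notin> shadow {e \<in> M. nsets e r \<inter> shadow S = {}})) = (\<Prod>s\<in>F. 1 - cov s)"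
    unfolding cov_def using F(2) by (intro prod.cong refl) (subst cover_sum[OF M], auto)
  also have "\<dots> = (\<Sum>A\<in>Pow F. (-1) ^ card A * (\<Prod>s\<in>A. cov s))"
    by (subst prod_diff_conv_sum[OF F(1)]) simp
  also have "unc F S * \<dots> = (\<Sum>A\<in>Pow F. (-1) ^ card A * (unc F S * (\<Prod>s\<in>A. cov s)))"
    by (simp add: sum_distrib_left mult_ac)
  also have "\<dots> = (\<Sum>A\<in>Pow F. (-1) ^ card A * (\<Sum>g\<in>PiE A star.
    unc (F \<union> (\<Union>s\<in>A. nsets (g s) r)) S * of_bool (g ` A \<subseteq> M)))"
  proof (intro sum.cong refl arg_cong2[of _ _ _ _ "(*)"])
    fix A assume "A \<in> Pow F"
    then have fA: "finite A" using F(1) finite_subset by auto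
    have "(\<Prod>s\<in>A. cov s) = (\<Sum>g\<in>PiE A star. \<Prod>s\<in>A. of_bool (g s \<in> M) * unc (nsets (g s) r) S)"
      unfolding cov_def by (intro prod_sum_PiE fA finite_star)
    also have "\<dots> = (\<Sum>g\<in>PiE A star. unc (\<Union>s\<in>A. nsets (g s) r) S * of_bool (g ` A \<subseteq> M))"
      by (intro sum.cong refl) (auto simp: prod.distrib prod_of_bool[OF fA] unc_UN[OF fA])
    finally show "unc F S * (\<Prod>s\<in>A. cov s) =
        (\<Sum>g\<in>PiE A star. unc (F \<union> (\<Union>s\<in>A. nsets (g s) r)) S * of_bool (g ` A \<subseteq> M))"
      by (simp add: sum_distrib_left unc_Un mult_ac)
  qed
  finally show ?thesis .
qed

text \<open>The probability that no member of \<open>F\<close> is covered after \<open>i\<close> rounds.\<close>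
definition free_prob :: "nat \<Rightarrow> 'a set set \<Rightarrow> real" where
  "free_prob i F = rexp i (unc F)"

lemma free_prob_bounds: "0 \<le> free_prob i F" "free_prob i F \<le> 1"
  using rexp_mono[of "\<lambda>_. 0" "unc F" i] rexp_mono[of "unc F" "\<lambda>_. 1" i]
  by (auto simp: free_prob_def rexp_const unc_def)

lemma match_exp_cong:
  assumes "\<And>M. packing M \<Longrightarrow> g M = h M"
  shows "match_exp g = match_exp h"
  by (rule antisym; rule match_exp_mono) (auto simp: assms)

lemma free_prob_Suc:
  assumes F: "finite F" "F \<subseteq> nsets V r"
  shows "free_prob (Suc i) F = (\<Sum>A\<in>Pow F. (-1) ^ card A * (\<Sum>g\<in>PiE A star.
    match_prob (g ` A) * free_prob i (F \<union> (\<Union>s\<in>A. nsets (g s) r))))"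
proof -
  have "match_exp (\<lambda>M. unc F (extend S M)) = (\<Sum>A\<in>Pow F. (-1) ^ card A * (\<Sum>g\<in>PiE A star.
      match_prob (g ` A) * unc (F \<union> (\<Union>s\<in>A. nsets (g s) r)) S))" for S
  proof -
    have "match_exp (\<lambda>M. unc F (extend S M)) = match_exp (\<lambda>M. \<Sum>A\<in>Pow F. (-1) ^ card A * (\<Sum>g\<in>PiE A star.
      unc (F \<union> (\<Union>s\<in>A. nsets (g s) r)) S * of_bool (g ` A \<subseteq> M)))"
      using F by (intro match_exp_cong unc_extend)
    then show ?thesis by (simp add: match_exp_sum) (simp add: match_prob_def mult.commute)
  qed
  then show ?thesis by (simp add: free_prob_def rexp_sum)
qed

section \<open>Clashing choices of covering blocks\<close>

text \<open>A choice \<open>g\<close> of blocks through the members of \<open>A\<close> clashes if its new points fail to be new: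
  a block meets \<open>\<Union>F\<close> outside its own \<open>r\<close>-set, or two blocks share a point outside theirs. Without
  a clash the blocks are compatible, and each contributes \<open>(q choose r) - 1\<close> further \<open>r\<close>-subsets that lie
  neither in \<open>F\<close> nor in another of the blocks.\<close>
definition clash :: "'a set set \<Rightarrow> 'a set set \<Rightarrow> ('a set \<Rightarrow> 'a set) \<Rightarrow> bool" where
  "clash F A g \<longleftrightarrow> (\<exists>s\<in>A. (g s - s) \<inter> \<Union>F \<noteq> {}) \<or>
     (\<exists>s\<in>A. \<exists>t\<in>A. s \<noteq> t \<and> (g s - s) \<inter> (g t - t) \<noteq> {})"

lemma no_clashD:
  assumes "\<not> clash F A g" "s \<in> A"
  shows "x \<in> g s - s \<Longrightarrow> T \<in> F \<Longrightarrow> x \<notin> T"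
    "t \<in> A \<Longrightarrow> s \<noteq> t \<Longrightarrow> x \<in> g s - s \<Longrightarrow> x \<notin> g t - t"
proof -
  have "(g s - s) \<inter> \<Union>F = {}" using assms unfolding clash_def by metis
  then show "x \<in> g s - s \<Longrightarrow> T \<in> F \<Longrightarrow> x \<notin> T" by blast
  assume "t \<in> A" "s \<noteq> t"
  then have "(g s - s) \<inter> (g t - t) = {}" using assms unfolding clash_def by metis
  then show "x \<in> g s - s \<Longrightarrow> x \<notin> g t - t" by blast
qed

lemma no_clash_inter:
  assumes "F \<subseteq> nsets V r" "A \<subseteq> F" "\<not> clash F A g" "s \<in> A" "t \<in> A" "s \<noteq> t"
  shows "g s \<inter> g t \<subseteq> s \<inter> t"
proof
  fix x assume x: "x \<in> g s \<inter> g t"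
  have F: "s \<in> F" "t \<in> F" using assms(2,4,5) by auto
  have "x \<in> s"
  proof (rule ccontr)
    assume "x \<notin> s"
    then have xs: "x \<in> g s - s" using x by simp
    from no_clashD(1)[OF assms(3,4) xs F(2)] no_clashD(2)[OF assms(3,4,5,6) xs] x
    show False by simp
  qed
  moreover have "x \<in> t"
  proof (rule ccontr)
    assume "x \<notin> t"
    then have "x \<in> g t - t" using x by simp
    from no_clashD(1)[OF assms(3,5) this F(1)] \<open>x \<in> s\<close> show False by simp
  qed
  ultimately show "x \<in> s \<inter> t" by blast
qed

lemma inter_rsets_less:
  assumes "s \<in> nsets V r" "t \<in> nsets V r" "s \<noteq> t"
  shows "card (s \<inter> t) < r"
proof -
  have "s \<inter> t \<subset> s" using assms rsetD card_subset_eq[of t s] by blast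
  then show ?thesis using psubset_card_mono[of s "s \<inter> t"] rsetD[OF assms(1)] by simp
qed

lemma no_clash_packing:
  assumes F: "F \<subseteq> nsets V r" "A \<subseteq> F" and g: "\<not> clash F A g" "g \<in> PiE A star"
  shows "packing (g ` A)" "card (g ` A) = card A"
proof -
  have less: "card (g s \<inter> g t) < r" if st: "s \<in> A" "t \<in> A" "s \<noteq> t" for s t
  proof -
    have "finite (s \<inter> t)" using F st rsetD by blast
    then have "card (g s \<inter> g t) \<le> card (s \<inter> t)"
      using no_clash_inter[OF F g(1) st] by (intro card_mono)
    also have "\<dots> < r" using F st by (intro inter_rsets_less) auto
    finally show ?thesis .
  qed
  have gQ: "g s \<in> Q" if "s \<in> A" for s using g(2) that by (auto simp: star_def PiE_def)
  have "inj_on g A"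
  proof (rule inj_onI, rule ccontr)
    fix s t assume st: "s \<in> A" "t \<in> A" "g s = g t" "s \<noteq> t"
    then show False using less[of s t] QD[OF gQ[of s]] r_less by simp
  qed
  then show "card (g ` A) = card A" by (rule card_image)
  show "packing (g ` A)" unfolding packing_def pairwise_def using less gQ by auto
qed

lemma no_clash_card:
  assumes F: "F \<subseteq> nsets V r" "A \<subseteq> F" "finite F" and g: "\<not> clash F A g" "g \<in> PiE A star"
  shows "F \<union> (\<Union>s\<in>A. nsets (g s) r) \<subseteq> nsets V r"
    "card (F \<union> (\<Union>s\<in>A. nsets (g s) r)) = card F + card A * ((q choose r) - 1)"
proof -
  have fA: "finite A" using F finite_subset by blast
  have gQ: "g s \<in> Q" "s \<subseteq> g s" if "s \<in> A" for s
    using PiE_mem[OF g(2) that] by (auto simp: star_def)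
  have gs: "finite (g s)" "card (g s) = q" "s \<in> nsets (g s) r" "g s \<subseteq> V" if "s \<in> A" for s
  proof -
    have "s \<in> nsets V r" using F(1,2) that by blast
    then have "finite s" "card s = r" using rsetD by auto
    then show "s \<in> nsets (g s) r" using gQ(2)[OF that] by (simp add: nsets_def)
    show "finite (g s)" "card (g s) = q" "g s \<subseteq> V" using QD[OF gQ(1)[OF that]] by auto
  qed
  show "F \<union> (\<Union>s\<in>A. nsets (g s) r) \<subseteq> nsets V r"
  proof (intro Un_least UN_least)
    fix s assume "s \<in> A"
    then show "nsets (g s) r \<subseteq> nsets V r" by (rule nsets_mono[OF gs(4)])
  qed (rule F(1))
  have new: "\<exists>x\<in>T. x \<in> g s - s" if "s \<in> A" "T \<in> nsets (g s) r - {s}" for s T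
  proof -
    have "s \<in> nsets V r" using F(1,2) that(1) by blast
    then have "finite s" "card s = r" using rsetD by auto
    moreover have T: "T \<noteq> s" "card T = r" "T \<subseteq> g s" using that(2) by (auto simp: nsets_def)
    ultimately have "\<not> T \<subseteq> s" using card_subset_eq[of s T] by auto
    then show ?thesis using T by blast
  qed
  define B where "B s = nsets (g s) r - {s}" for s
  have fB: "finite (B s)" if "s \<in> A" for s
    using gs[OF that] by (simp add: B_def finite_imp_finite_nsets)
  have cB: "card (B s) = (q choose r) - 1" if "s \<in> A" for s
    using gs[OF that] by (simp add: B_def card_nsets)
  have eq: "F \<union> (\<Union>s\<in>A. nsets (g s) r) = F \<union> (\<Union>s\<in>A. B s)"
    using F by (auto simp: B_def)
  have d1: "F \<inter> (\<Union>s\<in>A. B s) = {}"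
  proof (rule ccontr)
    assume "\<not> ?thesis"
    then obtain s T where "s \<in> A" "T \<in> F" "T \<in> B s" by blast
    moreover from this obtain x where "x \<in> T" "x \<in> g s - s"
      using new[of s T] unfolding B_def by auto
    ultimately show False using no_clashD(1)[OF g(1), of s x T] by simp
  qed
  have d2: "B s \<inter> B t = {}" if st: "s \<in> A" "t \<in> A" "s \<noteq> t" for s t
  proof (rule ccontr)
    assume "B s \<inter> B t \<noteq> {}"
    then obtain T where T: "T \<in> B s" "T \<in> B t" by blast
    then obtain x where "x \<in> T" "x \<in> g s - s" using new[of s T] st unfolding B_def by blast
    moreover have "T \<subseteq> g t" using T by (auto simp: B_def nsets_def)
    ultimately show False using no_clash_inter[OF F(1,2) g(1) st] by blast
  qed
  have "card (F \<union> (\<Union>s\<in>A. B s)) = card F + card (\<Union>s\<in>A. B s)"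
    using F fA fB d1 by (intro card_Un_disjoint) auto
  also have "card (\<Union>s\<in>A. B s) = (\<Sum>s\<in>A. card (B s))"
    using fA fB d2 by (intro card_UN_disjoint) auto
  also have "\<dots> = card A * ((q choose r) - 1)" by (simp add: cB)
  finally show "card (F \<union> (\<Union>s\<in>A. nsets (g s) r)) = card F + card A * ((q choose r) - 1)"
    by (simp only: eq)
qed

lemma card_star_meeting_le:
  assumes "s \<in> nsets V r" "finite X"
  shows "real (card {e \<in> star s. (e - s) \<inter> X \<noteq> {}}) * p \<le> card X / n"
proof -
  have "{e \<in> star s. (e - s) \<inter> X \<noteq> {}} \<subseteq> (\<Union>x\<in>X - s. {e \<in> Q. insert x s \<subseteq> e})"
    by (auto simp: star_def)
  then have "card {e \<in> star s. (e - s) \<inter> X \<noteq> {}} \<le> card (\<Union>x\<in>X - s. {e \<in> Q. insert x s \<subseteq> e})"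
    using finQ assms by (intro card_mono finite_UN_I) auto
  also have "\<dots> \<le> (\<Sum>x\<in>X - s. card {e \<in> Q. insert x s \<subseteq> e})"
    using assms by (intro card_UN_le) auto
  also have "\<dots> \<le> (\<Sum>x\<in>X - s. n ^ (q - r - 1))"
  proof (rule sum_mono)
    fix x assume "x \<in> X - s"
    then have "card (insert x s) = r + 1" "finite (insert x s)" using rsetD[OF assms(1)] by auto
    then show "card {e \<in> Q. insert x s \<subseteq> e} \<le> n ^ (q - r - 1)"
      using card_containing_le[of "insert x s"] r_less by simp
  qed
  also have "\<dots> = card (X - s) * n ^ (q - r - 1)" by simp
  also have "\<dots> \<le> card X * n ^ (q - r - 1)" using assms by (intro mult_right_mono card_mono) auto
  finally have "real (card {e \<in> star s. (e - s) \<inter> X \<noteq> {}}) * p \<le> real (card X * n ^ (q - r - 1)) * p"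
    using p_pos by (intro mult_right_mono) (auto simp del: of_nat_mult of_nat_power)
  also have "\<dots> = real (card X) * (p * real (n ^ (q - r - 1)))" by simp
  also have "\<dots> = card X / n" by (simp only: p_mult_power) simp
  finally show ?thesis .
qed

lemma card_Union_rsets_le:
  assumes "finite F" "F \<subseteq> nsets V r"
  shows "finite (\<Union>F)" "card (\<Union>F) \<le> card F * r"
proof -
  show "finite (\<Union>F)" using assms rsetD by blast
  have "card (\<Union>F) \<le> (\<Sum>s\<in>F. card s)" by (rule card_Union_le_sum_card)
  also have "\<dots> = (\<Sum>s\<in>F. r)" using assms rsetD by (intro sum.cong) auto
  finally show "card (\<Union>F) \<le> card F * r" by simp
qed

text \<open>For a packing \<open>M\<close> at most one choice \<open>g\<close> has all its blocks in \<open>M\<close>. If that \<open>g\<close> clashes, then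
  \<open>M\<close> contains one of few witnesses of a clash, consisting of one or two blocks.\<close>
lemma sum_clash_match_prob_le:
  assumes F: "finite F" "F \<subseteq> nsets V r" "A \<subseteq> F"
  shows "(\<Sum>g\<in>{g \<in> PiE A star. clash F A g}. match_prob (g ` A)) \<le> 2 * (card F)\<^sup>2 * q / n"
proof -
  have fA: "finite A" using F finite_subset by blast
  have Ar: "s \<in> nsets V r" if "s \<in> A" for s using F that by auto
  let ?W = "\<Union>F"
  let ?C = "{g \<in> PiE A star. clash F A g}"
  define near where "near s = {e \<in> star s. (e - s) \<inter> ?W \<noteq> {}}" for s
  define meet where "meet s e t = {f \<in> star t. (f - t) \<inter> (e - s) \<noteq> {}} - {e}" for s e t :: "'a set"
  define Z1 where "Z1 = (\<Union>s\<in>A. (\<lambda>e. {e}) ` near s)"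
  define Z2 where "Z2 = (\<Union>s\<in>A. \<Union>t\<in>A. \<Union>e\<in>star s. (\<lambda>f. {e, f}) ` meet s e t)"
  have fin: "finite (near s)" "finite (meet s e t)" for s e t
    using finite_star by (auto simp: near_def meet_def)
  have finZ: "finite (Z1 \<union> Z2)" using fA fin finite_star by (auto simp: Z1_def Z2_def)
  have wit: "\<exists>E\<in>Z1 \<union> Z2. E \<subseteq> g ` A" if g: "g \<in> PiE A star" and c: "clash F A g" for g
  proof -
    have gs: "g s \<in> star s" if "s \<in> A" for s using g that by auto
    have one: ?thesis if "s \<in> A" "(g s - s) \<inter> ?W \<noteq> {}" for s
    proof -
      have "{g s} \<in> Z1" using that gs[of s] by (auto simp: Z1_def near_def)
      then show ?thesis using that by (intro bexI[of _ "{g s}"]) auto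
    qed
    from c consider s where "s \<in> A" "(g s - s) \<inter> ?W \<noteq> {}"
      | s t where "s \<in> A" "t \<in> A" "s \<noteq> t" "(g s - s) \<inter> (g t - t) \<noteq> {}"
      unfolding clash_def by metis
    then show ?thesis
    proof cases
      case 1
      then show ?thesis by (rule one)
    next
      case 2
      show ?thesis
      proof (cases "g t = g s")
        case True
        \<comment> \<open>One block through \<open>s\<close> and \<open>t\<close> contains a point of \<open>t\<close> outside \<open>s\<close>, so it is a witness alone.\<close>
        have "\<not> t \<subseteq> s" using Ar 2 rsetD card_subset_eq by metis
        moreover have "t \<subseteq> g s" using gs[of t] 2 True by (auto simp: star_def)
        moreover have "t \<subseteq> ?W" using 2 F by auto
        ultimately have "(g s - s) \<inter> ?W \<noteq> {}" by blast
        with 2 show ?thesis by (intro one)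
      next
        case False
        then have "g t \<in> meet s (g s) t" using 2 gs[of t] by (auto simp: meet_def)
        then have "{g s, g t} \<in> Z2" using 2 gs[of s] unfolding Z2_def by blast
        then show ?thesis using 2 by (intro bexI[of _ "{g s, g t}"]) auto
      qed
    qed
  qed
  have pt: "(\<Sum>g\<in>?C. of_bool (g ` A \<subseteq> M)) \<le> (\<Sum>E\<in>Z1 \<union> Z2. of_bool (E \<subseteq> M) :: real)"
    if M: "packing M" for M
  proof (cases "\<exists>g\<in>?C. g ` A \<subseteq> M")
    case False
    then have "(\<Sum>g\<in>?C. of_bool (g ` A \<subseteq> M) :: real) = 0" by simp
    then show ?thesis by (simp add: sum_nonneg)
  next
    case True
    then obtain g0 where g0: "g0 \<in> ?C" "g0 ` A \<subseteq> M" by blast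
    have uniq: "g = g0" if "g \<in> ?C" "g ` A \<subseteq> M" for g
    proof (rule PiE_ext[of _ A star])
      show "g \<in> PiE A star" "g0 \<in> PiE A star" using that g0 by auto
      fix s assume s: "s \<in> A"
      then have "g s \<in> star s" "g0 s \<in> star s" using that g0 by auto
      then have "s \<subseteq> g s" "s \<subseteq> g0 s" by (auto simp: star_def)
      then show "g s = g0 s"
        using packingD[OF M _ _ \<open>s \<subseteq> g s\<close> \<open>s \<subseteq> g0 s\<close>] s that(2) g0(2) rsetD[OF Ar[OF s]]
        by (simp add: image_subset_iff)
    qed
    have "(\<Sum>g\<in>?C. of_bool (g ` A \<subseteq> M)) \<le> (\<Sum>g\<in>?C. if g = g0 then 1 else 0 :: real)"
    proof (rule sum_mono)
      fix g assume "g \<in> ?C"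
      then show "of_bool (g ` A \<subseteq> M) \<le> (if g = g0 then 1 else 0 :: real)"
        using uniq[of g] by (cases "g ` A \<subseteq> M") auto
    qed
    also have "\<dots> \<le> 1"
      using finite_PiE[OF fA, of star] finite_star by simp
    finally have "(\<Sum>g\<in>?C. of_bool (g ` A \<subseteq> M)) \<le> (1::real)" .
    moreover obtain E where "E \<in> Z1 \<union> Z2" "E \<subseteq> g0 ` A" using wit g0(1) by blast
    then have "1 \<le> (\<Sum>E\<in>Z1 \<union> Z2. of_bool (E \<subseteq> M) :: real)"
      using member_le_sum[of E "Z1 \<union> Z2" "\<lambda>E. of_bool (E \<subseteq> M) :: real"] finZ
        order.trans[OF _ g0(2), of E] by (simp del: sum_of_bool_eq)
    ultimately show ?thesis by simp
  qed
  have "(\<Sum>g\<in>?C. match_prob (g ` A)) \<le> (\<Sum>E\<in>Z1 \<union> Z2. match_prob E)"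
    using match_exp_mono[of "\<lambda>M. \<Sum>g\<in>?C. of_bool (g ` A \<subseteq> M)" "\<lambda>M. \<Sum>E\<in>Z1 \<union> Z2. of_bool (E \<subseteq> M)", OF pt]
      match_exp_sum[of "\<lambda>_. 1" "\<lambda>g M. of_bool (g ` A \<subseteq> M)" ?C]
      match_exp_sum[of "\<lambda>_. 1" "\<lambda>E M. of_bool (E \<subseteq> M)" "Z1 \<union> Z2"]
    by (simp add: match_prob_def del: sum_of_bool_eq)
  also have "\<dots> \<le> (\<Sum>E\<in>Z1. match_prob E) + (\<Sum>E\<in>Z2. match_prob E)"
    using finZ sum.union_inter[of Z1 Z2 match_prob]
      sum_nonneg[of "Z1 \<inter> Z2" match_prob] match_prob_nonneg by auto
  also have "(\<Sum>E\<in>Z1. match_prob E) \<le> (card F)\<^sup>2 * q / n"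
  proof -
    have "(\<Sum>E\<in>Z1. match_prob E) \<le> (\<Sum>E\<in>Z1. p)"
      by (intro sum_mono order.trans[OF match_prob_le]) (auto simp: Z1_def)
    also have "\<dots> = real (card Z1) * p" by simp
    also have "\<dots> \<le> real (\<Sum>s\<in>A. card (near s)) * p"
    proof -
      have "card Z1 \<le> (\<Sum>s\<in>A. card ((\<lambda>e. {e}) ` near s))"
        unfolding Z1_def using fA by (intro card_UN_le)
      also have "\<dots> \<le> (\<Sum>s\<in>A. card (near s))" using fin by (intro sum_mono card_image_le)
      finally show ?thesis using p_pos by (intro mult_right_mono) (auto simp del: of_nat_sum)
    qed
    also have "\<dots> = (\<Sum>s\<in>A. real (card (near s)) * p)" by (simp add: sum_distrib_right)
    also have "\<dots> \<le> (\<Sum>s\<in>A. card ?W / n)"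
      unfolding near_def using Ar card_Union_rsets_le[OF F(1,2)]
      by (intro sum_mono card_star_meeting_le) auto
    also have "\<dots> = real (card A * card ?W) / n" by simp
    also have "\<dots> \<le> real (card F * (card F * q)) / n"
    proof -
      have "card ?W \<le> card F * q"
        using card_Union_rsets_le(2)[OF F(1,2)] r_less
        by (meson le_trans less_imp_le mult_le_mono2)
      then have "card A * card ?W \<le> card F * (card F * q)"
        using F by (intro mult_mono card_mono) auto
      then show ?thesis by (intro divide_right_mono) (auto simp del: of_nat_mult)
    qed
    finally show ?thesis by (simp add: power2_eq_square mult_ac)
  qed
  also have "(\<Sum>E\<in>Z2. match_prob E) \<le> (card F)\<^sup>2 * q / n"
  proof -
    have "(\<Sum>E\<in>Z2. match_prob E) \<le> (\<Sum>E\<in>Z2. p\<^sup>2)"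
    proof (intro sum_mono)
      fix E assume "E \<in> Z2"
      then obtain e f where "E = {e, f}" "f \<noteq> e" by (auto simp: Z2_def meet_def)
      then have "card E = 2" by simp
      then show "match_prob E \<le> p\<^sup>2" using match_prob_le[of E] by simp
    qed
    also have "\<dots> = real (card Z2) * p\<^sup>2" by simp
    also have "\<dots> \<le> real (\<Sum>s\<in>A. \<Sum>t\<in>A. \<Sum>e\<in>star s. card (meet s e t)) * p\<^sup>2"
    proof -
      have "card Z2 \<le> (\<Sum>s\<in>A. \<Sum>t\<in>A. \<Sum>e\<in>star s. card ((\<lambda>f. {e, f}) ` meet s e t))"
        unfolding Z2_def using fA finite_star
        by (intro order.trans[OF card_UN_le] sum_mono order.refl) auto
      also have "\<dots> \<le> (\<Sum>s\<in>A. \<Sum>t\<in>A. \<Sum>e\<in>star s. card (meet s e t))"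
        using fin by (intro sum_mono card_image_le)
      finally show ?thesis by (intro mult_right_mono) (auto simp del: of_nat_sum)
    qed
    also have "\<dots> = (\<Sum>s\<in>A. \<Sum>t\<in>A. \<Sum>e\<in>star s. p * (real (card (meet s e t)) * p))"
      by (simp add: sum_distrib_right sum_distrib_left power2_eq_square mult_ac)
    also have "\<dots> \<le> (\<Sum>s\<in>A. \<Sum>t\<in>A. \<Sum>e\<in>star s. p * (q / n))"
    proof (intro sum_mono mult_left_mono)
      fix s t e assume *: "s \<in> A" "t \<in> A" "e \<in> star s"
      then have e: "finite e" "card e = q" using QD by (auto simp: star_def)
      have "card (meet s e t) \<le> card {f \<in> star t. (f - t) \<inter> (e - s) \<noteq> {}}"
        unfolding meet_def using finite_star by (intro card_mono) auto
      then have "real (card (meet s e t)) * p \<le> real (card {f \<in> star t. (f - t) \<inter> (e - s) \<noteq> {}}) * p"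
        using p_pos by (intro mult_right_mono) auto
      also have "\<dots> \<le> card (e - s) / n" using * e Ar by (intro card_star_meeting_le) auto
      also have "\<dots> \<le> q / n"
        using e card_mono[of e "e - s"] by (intro divide_right_mono) auto
      finally show "real (card (meet s e t)) * p \<le> q / n" .
    qed (use p_pos in auto)
    also have "\<dots> = (\<Sum>s\<in>A. \<Sum>t\<in>A. real deg * p * (q / n))"
      using Ar by (simp add: card_star)
    also have "\<dots> \<le> (\<Sum>s\<in>A. \<Sum>t\<in>A. 1 * (q / n))"
      using deg_p_le by (intro sum_mono mult_right_mono) auto
    also have "\<dots> = (card A)\<^sup>2 * (q / n)" by (simp add: power2_eq_square)
    also have "\<dots> \<le> (card F)\<^sup>2 * (q / n)"
      using F by (intro mult_right_mono power_mono) (auto intro: card_mono)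
    finally show ?thesis by simp
  qed
  finally show ?thesis by (simp add: mult_ac)
qed

end

section \<open>The limiting density of uncovered sets\<close>

text \<open>The idealised fraction of uncovered \<open>r\<close>-sets. In a round it drops by \<open>\<rho>\<close> times the chance that
  all \<open>K\<close> of the \<open>r\<close>-subsets of a block are uncovered.\<close>
primrec density :: "real \<Rightarrow> nat \<Rightarrow> nat \<Rightarrow> real" where
  "density \<rho> K 0 = 1"
| "density \<rho> K (Suc i) = density \<rho> K i - \<rho> * density \<rho> K i ^ K"

lemma density_bounds:
  assumes "0 \<le> \<rho>" "\<rho> \<le> 1" "1 \<le> K"
  shows "0 \<le> density \<rho> K i \<and> density \<rho> K i \<le> 1"
proof (induction i)
  case 0
  then show ?case by simp
next
  case (Suc i)
  let ?x = "density \<rho> K i"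
  have "?x ^ K \<le> ?x ^ 1" using Suc assms by (intro power_decreasing) auto
  then have "\<rho> * ?x ^ K \<le> 1 * ?x" using assms Suc by (intro mult_mono) auto
  moreover have "0 \<le> \<rho> * ?x ^ K" using assms Suc by simp
  ultimately show ?case using Suc by simp
qed

text \<open>A bound, independent of the number \<open>n\<close> of points, for \<open>n\<close> times the deviation from the
  idealised probability for \<open>v\<close> sets after the given number of rounds; it is far from sharp.\<close>
primrec err :: "nat \<Rightarrow> nat \<Rightarrow> nat \<Rightarrow> nat \<Rightarrow> real" where
  "err q K 0 v = 0"
| "err q K (Suc i) v = 2 ^ v * ((real v)\<^sup>2 * 4 ^ q + 4 * (real v)\<^sup>2 * q + (\<Sum>b\<le>v. err q K i (v + b * (K - 1))))"

lemma err_nonneg: "0 \<le> err q K i v"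
proof (induction i arbitrary: v)
  case (Suc i)
  then show ?case unfolding err.simps
    by (intro mult_nonneg_nonneg add_nonneg_nonneg sum_nonneg) auto
qed simp

context greedy_rounds
begin

abbreviation K :: nat where "K \<equiv> q choose r"

text \<open>The probability that the proposal of a round covers a given \<open>r\<close>-set.\<close>
definition rho :: real where "rho = deg * edge_prob"

lemma K_pos: "1 \<le> K"
  using r_less by (simp add: Suc_leI)

lemma rho_bounds: "0 \<le> rho" "rho \<le> 1"
proof -
  show "0 \<le> rho" using edge_prob_bounds by (simp add: rho_def)
  have "rho \<le> deg * p" unfolding rho_def using edge_prob_bounds by (intro mult_left_mono) auto
  then show "rho \<le> 1" using deg_p_le by simp
qed

lemma card_PiE_p_le:
  assumes A: "finite A" "A \<subseteq> nsets V r" and B: "\<And>t. t \<in> A \<Longrightarrow> B t \<subseteq> star t"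
  shows "s \<in> A \<Longrightarrow> real (card (PiE A B)) * p ^ card A \<le> real (card (B s)) * p"
    "s \<in> A \<Longrightarrow> t \<in> A \<Longrightarrow> s \<noteq> t \<Longrightarrow>
      real (card (PiE A B)) * p ^ card A \<le> (real (card (B s)) * p) * (real (card (B t)) * p)"
proof -
  define f where "f t = real (card (B t)) * p" for t
  have f: "0 \<le> f t \<and> f t \<le> 1" if "t \<in> A" for t
  proof -
    have "card (B t) \<le> card (star t)" using B[OF that] finite_star by (intro card_mono)
    also have "\<dots> = deg" using A that by (intro card_star) auto
    finally have "f t \<le> deg * p" unfolding f_def using p_pos by (intro mult_right_mono) auto
    moreover have "0 \<le> f t" using p_pos by (simp add: f_def)
    ultimately show ?thesis using deg_p_le by linarith
  qed
  have eq: "real (card (PiE A B)) * p ^ card A = (\<Prod>t\<in>A. f t)"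
    using A(1) by (simp add: card_PiE f_def prod.distrib)
  { assume s: "s \<in> A"
    have "(\<Prod>t\<in>A. f t) = f s * (\<Prod>t\<in>A - {s}. f t)" using A(1) s by (rule prod.remove)
    also have "\<dots> \<le> f s * 1" using f s by (intro mult_left_mono prod_le_1) auto
    finally show "real (card (PiE A B)) * p ^ card A \<le> real (card (B s)) * p"
      by (simp add: eq f_def) }
  { assume st: "s \<in> A" "t \<in> A" "s \<noteq> t"
    have "(\<Prod>t\<in>A. f t) = f s * (\<Prod>t\<in>A - {s}. f t)" using A(1) st(1) by (rule prod.remove)
    also have "(\<Prod>t\<in>A - {s}. f t) = f t * (\<Prod>t\<in>A - {s} - {t}. f t)"
      using A(1) st by (intro prod.remove) auto
    also have "f s * \<dots> \<le> f s * (f t * 1)"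
      using f st by (intro mult_left_mono prod_le_1) auto
    finally show "real (card (PiE A B)) * p ^ card A \<le> (real (card (B s)) * p) * (real (card (B t)) * p)"
      by (simp add: eq f_def) }
qed

text \<open>The number of clashing choices is small compared with the number of all choices.\<close>
lemma card_clash_le:
  assumes F: "finite F" "F \<subseteq> nsets V r" "A \<subseteq> F"
  shows "real (card {g \<in> PiE A star. clash F A g}) * p ^ card A \<le> 2 * (card F)\<^sup>2 * q / n"
proof -
  have fA: "finite A" using F finite_subset by blast
  have Ar: "s \<in> nsets V r" if "s \<in> A" for s using F that by auto
  let ?W = "\<Union>F"
  let ?C = "{g \<in> PiE A star. clash F A g}"
  define near where "near s = {e \<in> star s. (e - s) \<inter> ?W \<noteq> {}}" for s
  define meet where "meet s e t = {f \<in> star t. (f - t) \<inter> (e - s) \<noteq> {}}" for s e t :: "'a set"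
  define B1 where "B1 s = PiE A (star(s := near s))" for s
  define B2 where "B2 s t e = PiE A (star(s := {e}, t := meet s e t))" for s t e
  have fin: "finite (near s)" "finite (meet s e t)" for s e t
    using finite_star by (auto simp: near_def meet_def)
  have finB: "finite (B1 s)" "finite (B2 s t e)" for s t e
    unfolding B1_def B2_def using fA finite_star fin by (auto intro!: finite_PiE)
  have "?C \<subseteq> (\<Union>s\<in>A. B1 s) \<union> (\<Union>s\<in>A. \<Union>t\<in>A - {s}. \<Union>e\<in>star s. B2 s t e)"
  proof
    fix g assume "g \<in> ?C"
    then have g: "g \<in> PiE A star" and c: "clash F A g" by auto
    have gs: "g s \<in> star s" if "s \<in> A" for s using g that by auto
    from c consider s where "s \<in> A" "(g s - s) \<inter> ?W \<noteq> {}"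
      | s t where "s \<in> A" "t \<in> A" "s \<noteq> t" "(g s - s) \<inter> (g t - t) \<noteq> {}"
      unfolding clash_def by metis
    then show "g \<in> (\<Union>s\<in>A. B1 s) \<union> (\<Union>s\<in>A. \<Union>t\<in>A - {s}. \<Union>e\<in>star s. B2 s t e)"
    proof cases
      case 1
      then have "g s \<in> near s" using gs by (simp add: near_def)
      then have "g \<in> B1 s" using g unfolding B1_def by (simp add: PiE_iff)
      then show ?thesis using 1 by blast
    next
      case 2
      then have "g t \<in> meet s (g s) t" using gs by (simp add: meet_def Int_commute)
      then have "g \<in> B2 s t (g s)" using g unfolding B2_def by (simp add: PiE_iff)
      then show ?thesis using 2 gs[of s] by blast
    qed
  qed
  then have "card ?C \<le> card ((\<Union>s\<in>A. B1 s) \<union> (\<Union>s\<in>A. \<Union>t\<in>A - {s}. \<Union>e\<in>star s. B2 s t e))"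
    using fA finite_star finB by (intro card_mono) auto
  also have "\<dots> \<le> card (\<Union>s\<in>A. B1 s) + card (\<Union>s\<in>A. \<Union>t\<in>A - {s}. \<Union>e\<in>star s. B2 s t e)"
    by (rule card_Un_le)
  also have "\<dots> \<le> (\<Sum>s\<in>A. card (B1 s)) + (\<Sum>s\<in>A. \<Sum>t\<in>A - {s}. \<Sum>e\<in>star s. card (B2 s t e))"
    using fA finite_star
    by (intro add_mono card_UN_le order.trans[OF card_UN_le] sum_mono) auto
  finally have "real (card ?C) * p ^ card A
      \<le> real ((\<Sum>s\<in>A. card (B1 s)) + (\<Sum>s\<in>A. \<Sum>t\<in>A - {s}. \<Sum>e\<in>star s. card (B2 s t e))) * p ^ card A"
    using p_pos by (intro mult_right_mono) (auto simp del: of_nat_sum of_nat_add)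
  also have "\<dots> = (\<Sum>s\<in>A. real (card (B1 s)) * p ^ card A) +
      (\<Sum>s\<in>A. \<Sum>t\<in>A - {s}. \<Sum>e\<in>star s. real (card (B2 s t e)) * p ^ card A)"
    by (simp add: sum_distrib_right distrib_right)
  also have "(\<Sum>s\<in>A. real (card (B1 s)) * p ^ card A) \<le> (\<Sum>s\<in>A. card ?W / n)"
  proof (rule sum_mono)
    fix s assume s: "s \<in> A"
    have "real (card (B1 s)) * p ^ card A \<le> real (card ((star(s := near s)) s)) * p"
      unfolding B1_def using F s by (intro card_PiE_p_le(1) fA) (auto simp: near_def)
    also have "\<dots> = real (card (near s)) * p" by simp
    also have "\<dots> \<le> card ?W / n"
      unfolding near_def using Ar[OF s] card_Union_rsets_le[OF F(1,2)]
      by (intro card_star_meeting_le) auto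
    finally show "real (card (B1 s)) * p ^ card A \<le> card ?W / n" .
  qed
  also have "(\<Sum>s\<in>A. card ?W / n) \<le> (card F)\<^sup>2 * q / n"
  proof -
    have "card ?W \<le> card F * q"
      using card_Union_rsets_le(2)[OF F(1,2)] r_less
      by (meson le_trans less_imp_le mult_le_mono2)
    then have "card A * card ?W \<le> card F * (card F * q)"
      using F by (intro mult_mono card_mono) auto
    then have "real (card A * card ?W) / n \<le> real (card F * (card F * q)) / n"
      by (intro divide_right_mono) (auto simp del: of_nat_mult)
    then show ?thesis by (simp add: power2_eq_square mult_ac)
  qed
  also have "(\<Sum>s\<in>A. \<Sum>t\<in>A - {s}. \<Sum>e\<in>star s. real (card (B2 s t e)) * p ^ card A)
      \<le> (\<Sum>s\<in>A. \<Sum>t\<in>A - {s}. \<Sum>e\<in>star s. p * (q / n))"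
  proof (intro sum_mono)
    fix s t e assume *: "s \<in> A" "t \<in> A - {s}" "e \<in> star s"
    then have e: "finite e" "card e = q" using QD by (auto simp: star_def)
    let ?B = "star(s := {e}, t := meet s e t)"
    have "real (card (B2 s t e)) * p ^ card A \<le> (real (card (?B s)) * p) * (real (card (?B t)) * p)"
      unfolding B2_def using F * by (intro card_PiE_p_le(2) fA) (auto simp: meet_def)
    also have "\<dots> = p * (real (card (meet s e t)) * p)"
    proof -
      have "?B s = {e}" "?B t = meet s e t" using * by auto
      then show ?thesis by (simp only:) simp
    qed
    also have "\<dots> \<le> p * (card (e - s) / n)"
      unfolding meet_def using * e Ar p_pos
      by (intro mult_left_mono card_star_meeting_le) auto
    also have "\<dots> \<le> p * (q / n)"
      using e card_mono[of e "e - s"] p_pos by (intro mult_left_mono divide_right_mono) auto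
    finally show "real (card (B2 s t e)) * p ^ card A \<le> p * (q / n)" .
  qed
  also have "\<dots> = (\<Sum>s\<in>A. \<Sum>t\<in>A - {s}. real deg * p * (q / n))"
    using Ar by (simp add: card_star)
  also have "\<dots> \<le> (\<Sum>s\<in>A. \<Sum>t\<in>A - {s}. 1 * (q / n))"
    using deg_p_le by (intro sum_mono mult_right_mono) auto
  also have "\<dots> \<le> (\<Sum>s\<in>A. \<Sum>t\<in>A. 1 * (q / n))"
    using fA by (intro sum_mono sum_mono2) auto
  also have "\<dots> = (card A)\<^sup>2 * (q / n)" by (simp add: power2_eq_square)
  also have "\<dots> \<le> (card F)\<^sup>2 * (q / n)"
    using F by (intro mult_right_mono power_mono) (auto intro: card_mono)
  finally show ?thesis by (simp add: mult_ac)
qed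

lemma free_prob_term_approx:
  assumes F: "finite F" "F \<subseteq> nsets V r" "A \<subseteq> F"
    and x: "0 \<le> x" "x \<le> 1" and c: "0 \<le> c"
    and IH: "\<And>F'. finite F' \<Longrightarrow> F' \<subseteq> nsets V r \<Longrightarrow> card F' = card F + card A * (K - 1) \<Longrightarrow>
      \<bar>free_prob i F' - x ^ card F'\<bar> \<le> c / n"
  shows "\<bar>(\<Sum>g\<in>PiE A star. match_prob (g ` A) * free_prob i (F \<union> (\<Union>s\<in>A. nsets (g s) r)))
      - rho ^ card A * x ^ (card F + card A * (K - 1))\<bar>
    \<le> ((real (card F))\<^sup>2 * 4 ^ q + 4 * (real (card F))\<^sup>2 * q + c) / n"
proof -
  let ?a = "card A" and ?v = "card F"
  let ?m = "?v + ?a * (K - 1)"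
  let ?P = "PiE A star"
  let ?C = "{g \<in> ?P. clash F A g}"
  let ?G = "{g \<in> ?P. \<not> clash F A g}"
  let ?U = "\<lambda>g. F \<union> (\<Union>s\<in>A. nsets (g s) r)"
  let ?D = "\<lambda>g. match_prob (g ` A) * free_prob i (?U g) - edge_prob ^ ?a * x ^ ?m"
  have fA: "finite A" using F finite_subset by blast
  have Ar: "s \<in> nsets V r" if "s \<in> A" for s using F that by auto
  have finP: "finite ?P" using fA finite_star by (intro finite_PiE)
  have av: "?a \<le> ?v" using F by (intro card_mono)
  have cP: "card ?P = deg ^ ?a" using Ar fA by (simp add: card_PiE card_star)
  have "rho ^ ?a * x ^ ?m = (\<Sum>g\<in>?P. edge_prob ^ ?a * x ^ ?m)"
    by (simp add: cP rho_def power_mult_distrib)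
  then have "\<bar>(\<Sum>g\<in>?P. match_prob (g ` A) * free_prob i (?U g)) - rho ^ ?a * x ^ ?m\<bar> = \<bar>\<Sum>g\<in>?P. ?D g\<bar>"
    by (simp only: sum_subtractf)
  also have "\<dots> \<le> (\<Sum>g\<in>?P. \<bar>?D g\<bar>)" by (rule sum_abs)
  also have "\<dots> = (\<Sum>g\<in>?G \<union> ?C. \<bar>?D g\<bar>)" by (intro sum.cong) auto
  also have "\<dots> = (\<Sum>g\<in>?G. \<bar>?D g\<bar>) + (\<Sum>g\<in>?C. \<bar>?D g\<bar>)"
    using finP by (intro sum.union_disjoint) auto
  also have "(\<Sum>g\<in>?G. \<bar>?D g\<bar>) \<le> (\<Sum>g\<in>?G. p ^ ?a * ((?v\<^sup>2 * 4 ^ q + c) / n))"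
  proof (rule sum_mono)
    fix g assume "g \<in> ?G"
    then have g: "\<not> clash F A g" "g \<in> ?P" by auto
    note pk = no_clash_packing[OF F(2,3) g] and U = no_clash_card[OF F(2,3,1) g]
    have finU: "finite (?U g)" using U(1) finite_imp_finite_nsets[OF finV] finite_subset by blast
    have m: "\<bar>match_prob (g ` A) - edge_prob ^ ?a\<bar> \<le> p ^ ?a * (?a\<^sup>2 * 4 ^ q / n)"
      using match_prob_approx[of "g ` A"] fA pk by simp
    have f: "\<bar>free_prob i (?U g) - x ^ ?m\<bar> \<le> c / n"
      using IH[OF finU U] unfolding U(2) .
    have "?D g = (match_prob (g ` A) - edge_prob ^ ?a) * free_prob i (?U g)
        + edge_prob ^ ?a * (free_prob i (?U g) - x ^ ?m)"
      by (simp add: algebra_simps)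
    also have "\<bar>\<dots>\<bar> \<le> \<bar>(match_prob (g ` A) - edge_prob ^ ?a) * free_prob i (?U g)\<bar>
        + \<bar>edge_prob ^ ?a * (free_prob i (?U g) - x ^ ?m)\<bar>" by (rule abs_triangle_ineq)
    also have "\<dots> \<le> (p ^ ?a * (?a\<^sup>2 * 4 ^ q / n)) * 1 + p ^ ?a * (c / n)"
      unfolding abs_mult using m f free_prob_bounds[of i "?U g"] edge_prob_bounds p_pos
      by (intro add_mono mult_mono) (auto intro!: power_mono)
    also have "\<dots> = p ^ ?a * ((?a\<^sup>2 * 4 ^ q + c) / n)" by (simp add: algebra_simps add_divide_distrib)
    also have "\<dots> \<le> p ^ ?a * ((?v\<^sup>2 * 4 ^ q + c) / n)"
      using av p_pos by (intro mult_left_mono divide_right_mono add_mono mult_right_mono power_mono) auto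
    finally show "\<bar>?D g\<bar> \<le> p ^ ?a * ((?v\<^sup>2 * 4 ^ q + c) / n)" .
  qed
  also have "(\<Sum>g\<in>?G. p ^ ?a * ((?v\<^sup>2 * 4 ^ q + c) / n)) \<le> (\<Sum>g\<in>?P. p ^ ?a * ((?v\<^sup>2 * 4 ^ q + c) / n))"
    using finP p_pos c by (intro sum_mono2) auto
  also have "\<dots> = (real deg * p) ^ ?a * ((?v\<^sup>2 * 4 ^ q + c) / n)"
    by (simp add: cP power_mult_distrib)
  also have "\<dots> \<le> 1 * ((?v\<^sup>2 * 4 ^ q + c) / n)"
    using deg_p_le p_pos c by (intro mult_right_mono power_le_one) auto
  also have "(\<Sum>g\<in>?C. \<bar>?D g\<bar>) \<le> (\<Sum>g\<in>?C. match_prob (g ` A) + p ^ ?a)"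
  proof (rule sum_mono)
    fix g
    have "0 \<le> match_prob (g ` A) * free_prob i (?U g)"
      "match_prob (g ` A) * free_prob i (?U g) \<le> match_prob (g ` A)"
      using free_prob_bounds[of i "?U g"] match_prob_nonneg[of "g ` A"]
      by (auto simp: mult_left_le)
    moreover have "0 \<le> edge_prob ^ ?a * x ^ ?m" using edge_prob_bounds x by simp
    moreover have "edge_prob ^ ?a * x ^ ?m \<le> p ^ ?a * 1"
      using edge_prob_bounds x p_pos by (intro mult_mono power_mono power_le_one) auto
    ultimately show "\<bar>?D g\<bar> \<le> match_prob (g ` A) + p ^ ?a" by simp
  qed
  also have "\<dots> = (\<Sum>g\<in>?C. match_prob (g ` A)) + real (card ?C) * p ^ ?a"
    by (simp add: sum.distrib)
  also have "\<dots> \<le> 2 * ?v\<^sup>2 * q / n + 2 * ?v\<^sup>2 * q / n"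
    using sum_clash_match_prob_le[OF F] card_clash_le[OF F] by (rule add_mono)
  finally show ?thesis by (simp add: add_divide_distrib algebra_simps)
qed

text \<open>Uncovered \<open>r\<close>-sets are asymptotically independent. The claim concerns arbitrary sets \<open>F\<close>,
  since the recursion replaces \<open>F\<close> by larger sets.\<close>
lemma free_prob_approx:
  assumes "finite F" "F \<subseteq> nsets V r"
  shows "\<bar>free_prob i F - density rho K i ^ card F\<bar> \<le> err q K i (card F) / n"
  using assms
proof (induction i arbitrary: F)
  case 0
  then show ?case by (simp add: free_prob_def unc_def shadow_def)
next
  case (Suc i)
  note F = Suc.prems
  let ?v = "card F" and ?x = "density rho K i"
  let ?m = "\<lambda>A. ?v + card A * (K - 1)"
  let ?X = "\<lambda>A. \<Sum>g\<in>PiE A star. match_prob (g ` A) * free_prob i (F \<union> (\<Union>s\<in>A. nsets (g s) r))"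
  let ?Y = "\<lambda>A. rho ^ card A * ?x ^ ?m A"
  let ?c = "\<Sum>b\<le>?v. err q K i (?v + b * (K - 1))"
  let ?b = "((real ?v)\<^sup>2 * 4 ^ q + 4 * (real ?v)\<^sup>2 * q + ?c) / n"
  have x: "0 \<le> ?x" "?x \<le> 1" using density_bounds[OF rho_bounds K_pos] by auto
  \<comment> \<open>The idealised value satisfies the same inclusion-exclusion formula.\<close>
  have "(?x - rho * ?x ^ K) ^ ?v = (\<Prod>s\<in>F. ?x - rho * ?x ^ K)" by simp
  also have "\<dots> = (\<Sum>A\<in>Pow F. (-1) ^ card A * (\<Prod>s\<in>A. rho * ?x ^ K) * (\<Prod>s\<in>F - A. ?x))"
    by (rule prod_diff_conv_sum[OF F(1)])
  also have "\<dots> = (\<Sum>A\<in>Pow F. (-1) ^ card A * ?Y A)"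
  proof (rule sum.cong)
    fix A assume "A \<in> Pow F"
    then have A: "A \<subseteq> F" "finite A" "card A \<le> ?v" using F finite_subset by (auto intro: card_mono)
    have "K * card A + (?v - card A) = ?m A"
    proof -
      obtain K' where "K = Suc K'" using K_pos by (metis Suc_le_D One_nat_def)
      then show ?thesis using A(3) by (simp add: algebra_simps)
    qed
    then have "?x ^ ?m A = (?x ^ K) ^ card A * ?x ^ (?v - card A)"
      by (metis power_add power_mult)
    then show "(-1) ^ card A * (\<Prod>s\<in>A. rho * ?x ^ K) * (\<Prod>s\<in>F - A. ?x) = (-1) ^ card A * ?Y A"
      using A by (simp add: card_Diff_subset power_mult_distrib)
  qed simp
  finally have Y: "(?x - rho * ?x ^ K) ^ ?v = (\<Sum>A\<in>Pow F. (-1) ^ card A * ?Y A)" .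
  have "\<bar>free_prob (Suc i) F - density rho K (Suc i) ^ ?v\<bar> = \<bar>\<Sum>A\<in>Pow F. (-1) ^ card A * (?X A - ?Y A)\<bar>"
    using free_prob_Suc[OF F, of i] Y by (simp add: sum_subtractf right_diff_distrib)
  also have "\<dots> \<le> (\<Sum>A\<in>Pow F. \<bar>(-1) ^ card A * (?X A - ?Y A)\<bar>)" by (rule sum_abs)
  also have "\<dots> = (\<Sum>A\<in>Pow F. \<bar>?X A - ?Y A\<bar>)" by (simp add: abs_mult power_abs)
  also have "\<dots> \<le> (\<Sum>A\<in>Pow F. ?b)"
  proof (rule sum_mono)
    fix A assume "A \<in> Pow F"
    then have A: "A \<subseteq> F" by simp
    have Av: "card A \<le> ?v" using A F by (intro card_mono)
    have c: "err q K i (?m A) \<le> ?c"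
      by (rule member_le_sum[where f = "\<lambda>b. err q K i (?v + b * (K - 1))"])
        (use Av err_nonneg in auto)
    show "\<bar>?X A - ?Y A\<bar> \<le> ?b"
    proof (rule free_prob_term_approx[OF F A x])
      show "0 \<le> ?c" by (intro sum_nonneg err_nonneg)
      fix F' assume F': "finite F'" "F' \<subseteq> nsets V r" "card F' = ?m A"
      have "\<bar>free_prob i F' - ?x ^ card F'\<bar> \<le> err q K i (?m A) / n"
        using Suc.IH[OF F'(1,2)] F'(3) by simp
      also have "\<dots> \<le> ?c / n" using c by (intro divide_right_mono) auto
      finally show "\<bar>free_prob i F' - ?x ^ card F'\<bar> \<le> ?c / n" .
    qed
  qed
  also have "\<dots> = err q K (Suc i) ?v / n" using F(1) by (simp add: card_Pow)
  finally show ?case .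
qed

end

text \<open>While the density exceeds \<open>\<delta>\<close>, each step lowers it by at least \<open>\<rho>0 * \<delta> ^ K\<close>.\<close>
lemma density_decreases_below:
  assumes "0 < \<rho>0" "0 < \<delta>"
  shows "\<exists>T. \<forall>\<rho>. \<rho>0 \<le> \<rho> \<longrightarrow> \<rho> \<le> 1 \<longrightarrow> 1 \<le> K \<longrightarrow> density \<rho> K T \<le> \<delta>"
proof -
  obtain T :: nat where T: "1 / (\<rho>0 * \<delta> ^ K) < T" using reals_Archimedean2 by blast
  have "density \<rho> K T \<le> \<delta>" if \<rho>: "\<rho>0 \<le> \<rho>" "\<rho> \<le> 1" and K: "1 \<le> K" for \<rho>
  proof (rule ccontr)
    assume large: "\<not> density \<rho> K T \<le> \<delta>"
    have bnd: "0 \<le> density \<rho> K i" for i using density_bounds[of \<rho> K] \<rho> K assms by simp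
    have dec: "density \<rho> K j \<le> density \<rho> K i" if "i \<le> j" for i j
      using that
    proof (induction j rule: dec_induct)
      case (step j)
      have "0 \<le> \<rho> * density \<rho> K j ^ K" using bnd \<rho> assms by simp
      then show ?case using step.IH by simp
    qed simp
    have "density \<rho> K i \<le> 1 - i * (\<rho>0 * \<delta> ^ K)" if "i \<le> T" for i
      using that
    proof (induction i)
      case (Suc i)
      have "\<delta> \<le> density \<rho> K i" using dec[of i T] large Suc.prems by simp
      then have "\<rho>0 * \<delta> ^ K \<le> \<rho> * density \<rho> K i ^ K"
        using assms \<rho> by (intro mult_mono power_mono) auto
      then show ?case using Suc by (simp add: algebra_simps)
    qed simp
    from this[of T] have "density \<rho> K T \<le> 1 - T * (\<rho>0 * \<delta> ^ K)" by simp
    moreover have "1 < T * (\<rho>0 * \<delta> ^ K)" using T assms by (simp add: divide_simps)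
    ultimately show False using bnd[of T] by linarith
  qed
  then show ?thesis by blast
qed

context greedy_rounds
begin

text \<open>The bound does not depend on \<open>n\<close>, so the number of rounds can be chosen before \<open>n\<close>.\<close>
lemma rho_lower_bound:
  "(1 / (2 * real (q - r))) ^ (q - r) * exp (- 2 * K) \<le> rho"
proof -
  have d: "0 < q - r" using r_less by simp
  have "(real n / (2 * real (q - r))) ^ (q - r) \<le> (real (n - r) / real (q - r)) ^ (q - r)"
  proof (rule power_mono)
    have "real n / 2 \<le> real (n - r)" using V_large r_less by simp
    then have "real n / 2 / real (q - r) \<le> real (n - r) / real (q - r)"
      by (rule divide_right_mono) simp
    then show "real n / (2 * real (q - r)) \<le> real (n - r) / real (q - r)" by simp
  qed simp
  also have "\<dots> \<le> real deg"
    unfolding deg_def using V_large by (intro binomial_ge_n_over_k_pow_k) auto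
  finally have "(real n / (2 * real (q - r))) ^ (q - r) * p \<le> deg * p"
    using p_pos by (intro mult_right_mono) auto
  moreover have "(real n / (2 * real (q - r))) ^ (q - r) * p = (1 / (2 * real (q - r))) ^ (q - r)"
    using n_ge by (simp add: p_def power_divide)
  ultimately have 1: "(1 / (2 * real (q - r))) ^ (q - r) \<le> deg * p" by simp
  have "- p - 2 * p\<^sup>2 \<le> ln (1 - p)"
    using p_pos p_le_half by (intro ln_one_minus_pos_lower_bound) auto
  moreover have "2 * p\<^sup>2 \<le> p" using p_pos p_le_half by (simp add: power2_eq_square)
  ultimately have "- 2 * p \<le> ln (1 - p)" by simp
  then have e: "exp (- 2 * p) \<le> 1 - p" using p_le_half by (simp add: ln_ge_iff)
  have "real num_nbrs \<le> real (K * n ^ (q - r))" using num_nbrs_le by (simp only: of_nat_le_iff)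
  then have "real num_nbrs * p \<le> real (K * n ^ (q - r)) * p" using p_pos by (intro mult_right_mono) auto
  also have "\<dots> = K" using n_ge by (simp add: p_def)
  finally have "exp (- 2 * K) \<le> exp (real num_nbrs * (- 2 * p))" by simp
  also have "\<dots> = exp (- 2 * p) ^ num_nbrs" by (rule exp_of_nat_mult)
  also have "\<dots> \<le> (1 - p) ^ num_nbrs" using e by (intro power_mono) auto
  finally have 2: "exp (- 2 * K) \<le> (1 - p) ^ num_nbrs" .
  have "(1 / (2 * real (q - r))) ^ (q - r) * exp (- 2 * K) \<le> (deg * p) * (1 - p) ^ num_nbrs"
    using 1 2 p_pos by (intro mult_mono) auto
  then show ?thesis by (simp add: rho_def edge_prob_def mult_ac)
qed

section \<open>Dense families of blocks\<close>

text \<open>Every block of the packing was proposed in some round, so \<open>E\<close> is contained in it with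
  probability of the order of \<open>p ^ card E\<close>.\<close>
lemma joint_prob_le:
  assumes "finite E"
  shows "rexp i (\<lambda>S. of_bool (E \<subseteq> S)) \<le> (real i * p) ^ card E"
  using assms
proof (induction i arbitrary: E)
  case 0
  then show ?case by (cases "E = {}") (auto simp: card_gt_0_iff)
next
  case (Suc i)
  have "match_exp (\<lambda>M. of_bool (E \<subseteq> extend S M)) \<le> (\<Sum>A\<in>Pow E. p ^ card (E - A) * of_bool (A \<subseteq> S))" for S
  proof -
    have "match_exp (\<lambda>M. of_bool (E \<subseteq> extend S M))
        \<le> match_exp (\<lambda>M. \<Sum>A\<in>Pow E. of_bool (A \<subseteq> S) * of_bool (E - A \<subseteq> M))"
    proof (rule match_exp_mono)
      fix M
      show "of_bool (E \<subseteq> extend S M) \<le> (\<Sum>A\<in>Pow E. of_bool (A \<subseteq> S) * of_bool (E - A \<subseteq> M) :: real)"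
      proof (cases "E \<subseteq> extend S M")
        case True
        have "of_bool (E \<inter> S \<subseteq> S) * of_bool (E - (E \<inter> S) \<subseteq> M)
          \<le> (\<Sum>A\<in>Pow E. of_bool (A \<subseteq> S) * of_bool (E - A \<subseteq> M) :: real)"
          by (rule member_le_sum) (use Suc.prems in auto)
        moreover have "E - (E \<inter> S) \<subseteq> M" using True by (auto simp: extend_def)
        ultimately show ?thesis using True by simp
      qed (simp add: sum_nonneg)
    qed
    also have "\<dots> = (\<Sum>A\<in>Pow E. of_bool (A \<subseteq> S) * match_prob (E - A))"
      by (simp only: match_exp_sum match_prob_def)
    also have "\<dots> \<le> (\<Sum>A\<in>Pow E. of_bool (A \<subseteq> S) * p ^ card (E - A))"
      by (intro sum_mono mult_left_mono match_prob_le) auto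
    finally show ?thesis by (simp only: mult.commute)
  qed
  then have "rexp (Suc i) (\<lambda>S. of_bool (E \<subseteq> S))
      \<le> rexp i (\<lambda>S. \<Sum>A\<in>Pow E. p ^ card (E - A) * of_bool (A \<subseteq> S))"
    by (simp only: rexp.simps) (rule rexp_mono)
  also have "\<dots> = (\<Sum>A\<in>Pow E. p ^ card (E - A) * rexp i (\<lambda>S. of_bool (A \<subseteq> S)))"
    by (rule rexp_sum)
  also have "\<dots> \<le> (\<Sum>A\<in>Pow E. p ^ card (E - A) * (real i * p) ^ card A)"
    using p_pos Suc.prems finite_subset by (intro sum_mono mult_left_mono Suc.IH) auto
  also have "\<dots> = (\<Sum>A\<in>Pow E. (\<Prod>e\<in>A. real i * p) * (\<Prod>e\<in>E - A. p))"
    by (simp add: mult.commute)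
  also have "\<dots> = (\<Prod>e\<in>E. real i * p + p)" using Suc.prems by (simp only: prod_add)
  also have "\<dots> = (real (Suc i) * p) ^ card E" by (simp add: algebra_simps)
  finally show ?case .
qed

text \<open>The largest number of points on which \<open>l\<close> blocks form a forbidden configuration.\<close>
definition cap :: "nat \<Rightarrow> nat" where "cap l = (l - 1) * (q - r) + r"

text \<open>The sets of \<open>l\<close> blocks that span at most \<open>cap l\<close> points.\<close>
definition dense_fams :: "nat \<Rightarrow> 'a set set set" where
  "dense_fams l = {E. E \<subseteq> Q \<and> card E = l \<and> card (\<Union>E) \<le> cap l}"

lemma finite_dense_fams: "finite (dense_fams l)"
  using finQ by (intro finite_subset[of "dense_fams l" "Pow Q"]) (auto simp: dense_fams_def)

lemma card_dense_fams_le: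
  assumes "cap l \<le> n"
  shows "card (dense_fams l) \<le> 2 ^ 2 ^ cap l * n ^ cap l"
proof -
  have "dense_fams l \<subseteq> (\<Union>J\<in>nsets V (cap l). Pow (Pow J))"
  proof
    fix E assume E: "E \<in> dense_fams l"
    then have sub: "\<Union>E \<subseteq> V" using QD by (auto simp: dense_fams_def)
    obtain J where "\<Union>E \<subseteq> J" "J \<subseteq> V" "card J = cap l"
      using E assms exists_subset_between[OF _ _ sub finV, of "cap l"]
      by (auto simp: dense_fams_def)
    then show "E \<in> (\<Union>J\<in>nsets V (cap l). Pow (Pow J))"
      using finite_subset[OF _ finV] by (auto simp: nsets_def intro!: exI[of _ J])
  qed
  then have "card (dense_fams l) \<le> card (\<Union>J\<in>nsets V (cap l). Pow (Pow J))"
    by (intro card_mono finite_UN_I finite_imp_finite_nsets finV) (auto simp: nsets_def)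
  also have "\<dots> \<le> (\<Sum>J\<in>nsets V (cap l). card (Pow (Pow J)))"
    by (intro card_UN_le finite_imp_finite_nsets finV)
  also have "\<dots> = (\<Sum>J\<in>nsets V (cap l). 2 ^ 2 ^ cap l)"
    by (intro sum.cong refl) (auto simp: nsets_def card_Pow)
  also have "\<dots> = (n choose cap l) * 2 ^ 2 ^ cap l" by (simp add: card_nsets finV)
  also have "\<dots> \<le> n ^ cap l * 2 ^ 2 ^ cap l"
    using assms by (intro mult_right_mono binomial_le_pow) auto
  finally show ?thesis by (simp add: mult.commute)
qed

text \<open>The exponents cancel to \<open>cap l - l * (q - r) = r - (q - r) \<le> r - 1\<close>, so few dense families
  are expected.\<close>
lemma expected_dense_fams_le:
  assumes "cap l \<le> n" "1 \<le> l"
  shows "(\<Sum>E\<in>dense_fams l. rexp T (\<lambda>S. of_bool (E \<subseteq> S)))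
    \<le> 2 ^ 2 ^ cap l * real T ^ l * (real n ^ r / n)"
proof -
  have n0: "0 < real n" using n_ge by simp
  have "(\<Sum>E\<in>dense_fams l. rexp T (\<lambda>S. of_bool (E \<subseteq> S))) \<le> (\<Sum>E\<in>dense_fams l. (real T * p) ^ l)"
  proof (rule sum_mono)
    fix E assume E: "E \<in> dense_fams l"
    then have "finite E" using finQ finite_subset by (auto simp: dense_fams_def)
    then show "rexp T (\<lambda>S. of_bool (E \<subseteq> S)) \<le> (real T * p) ^ l"
      using joint_prob_le[of E T] E by (simp add: dense_fams_def)
  qed
  also have "\<dots> = real (card (dense_fams l)) * (real T * p) ^ l" by simp
  also have "\<dots> \<le> real (2 ^ 2 ^ cap l * n ^ cap l) * (real T * p) ^ l"
  proof (rule mult_right_mono)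
    show "real (card (dense_fams l)) \<le> real (2 ^ 2 ^ cap l * n ^ cap l)"
      using card_dense_fams_le[OF assms(1)] by (simp only: of_nat_le_iff)
  qed (use p_pos in simp)
  also have "\<dots> = 2 ^ 2 ^ cap l * real T ^ l * (real n ^ cap l * p ^ l)"
    by (simp add: power_mult_distrib)
  also have "real n ^ cap l * p ^ l = real n ^ r / real n ^ (q - r)"
  proof -
    obtain m where l: "l = Suc m" using assms(2) by (cases l) auto
    have "real n ^ cap l * p ^ l = real n ^ (m * (q - r)) * real n ^ r * (p ^ m * p)"
      by (simp add: l cap_def power_add)
    also have "p ^ m = 1 / real n ^ (m * (q - r))"
      by (simp add: p_def power_divide mult.commute flip: power_mult)
    finally show ?thesis using n0 by (simp add: p_def)
  qed
  also have "real n ^ r / real n ^ (q - r) \<le> real n ^ r / n"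
  proof -
    have "real n ^ 1 \<le> real n ^ (q - r)" using n_ge r_less by (intro power_increasing) auto
    then show ?thesis using n0 by (intro divide_left_mono) auto
  qed
  finally show ?thesis by (simp add: mult_left_mono)
qed

lemma card_shadow:
  assumes "packing S"
  shows "card (shadow S) = card S * K" "shadow S \<subseteq> nsets V r"
proof -
  have SQ: "S \<subseteq> Q" using assms by (simp add: packing_def)
  then have fS: "finite S" using finQ finite_subset by blast
  have "card (shadow S) = (\<Sum>e\<in>S. card (nsets e r))"
    unfolding shadow_def
  proof (intro card_UN_disjoint fS ballI impI)
    fix e assume "e \<in> S"
    then show "finite (nsets e r)" using SQ QD by (intro finite_imp_finite_nsets) auto
  next
    fix e f assume ef: "e \<in> S" "f \<in> S" "e \<noteq> f"
    show "nsets e r \<inter> nsets f r = {}"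
      using packingD[OF assms ef(1,2)] ef(3) by (auto simp: nsets_def)
  qed
  also have "\<dots> = (\<Sum>e\<in>S. K)" using SQ QD by (intro sum.cong refl) (auto simp: card_nsets)
  finally show "card (shadow S) = card S * K" by simp
  show "shadow S \<subseteq> nsets V r" using SQ unfolding shadow_def nsets_def by blast
qed

lemma rexp_add: "rexp i (\<lambda>S. g S + h S) = rexp i g + rexp i h"
  using rexp_sum[of i "\<lambda>_. 1" "\<lambda>b. if b then g else h" "UNIV :: bool set"]
  by (simp add: UNIV_bool add.commute)

lemma rexp_sum_plain: "rexp i (\<lambda>S. \<Sum>x\<in>X. g x S) = (\<Sum>x\<in>X. rexp i (g x))"
  using rexp_sum[of i "\<lambda>_. 1" g X] by simp

section \<open>Almost perfect weakly sparse packings\<close>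

text \<open>For some outcome after \<open>T\<close> rounds, the number \<open>n choose r - card S * K\<close> of uncovered \<open>r\<close>-sets
  plus \<open>K\<close> times the number of dense families contained in \<open>S\<close> does not exceed its expectation.\<close>
lemma ex_good_packing:
  assumes "\<And>l. l \<in> L \<Longrightarrow> 1 \<le> l \<and> cap l \<le> n" "finite L"
  shows "\<exists>S. packing S \<and>
    real (n choose r) - real (card S) * K + real K * (\<Sum>l\<in>L. real (card {E \<in> dense_fams l. E \<subseteq> S}))
    \<le> (density rho K T + err q K T 1 / n) * (n choose r)
      + real K * (\<Sum>l\<in>L. 2 ^ 2 ^ cap l * real T ^ l * (real n ^ r / n))"
proof -
  let ?R = "nsets V r"
  define g where "g = (\<lambda>S. (\<Sum>s\<in>?R. unc {s} S)
    + real K * (\<Sum>l\<in>L. (\<Sum>E\<in>dense_fams l. (of_bool (E \<subseteq> S) :: real))))"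
  obtain S where S: "packing S" "g S \<le> rexp T g" using ex_packing_le_rexp by blast
  have fR: "finite ?R" using finV by (rule finite_imp_finite_nsets)
  have "rexp T g = rexp T (\<lambda>S. \<Sum>s\<in>?R. unc {s} S)
      + rexp T (\<lambda>S. real K * (\<Sum>l\<in>L. (\<Sum>E\<in>dense_fams l. (of_bool (E \<subseteq> S) :: real))))"
    unfolding g_def by (rule rexp_add)
  also have "rexp T (\<lambda>S. real K * (\<Sum>l\<in>L. (\<Sum>E\<in>dense_fams l. (of_bool (E \<subseteq> S) :: real))))
      = real K * rexp T (\<lambda>S. \<Sum>l\<in>L. (\<Sum>E\<in>dense_fams l. (of_bool (E \<subseteq> S) :: real)))"
    by (rule rexp_cmult)
  finally have "rexp T g = (\<Sum>s\<in>?R. free_prob T {s})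
      + real K * (\<Sum>l\<in>L. \<Sum>E\<in>dense_fams l. rexp T (\<lambda>S. of_bool (E \<subseteq> S)))"
    by (simp only: rexp_sum_plain free_prob_def)
  also have "\<dots> \<le> (\<Sum>s\<in>?R. density rho K T + err q K T 1 / n)
      + real K * (\<Sum>l\<in>L. 2 ^ 2 ^ cap l * real T ^ l * (real n ^ r / n))"
  proof (intro add_mono sum_mono mult_left_mono expected_dense_fams_le)
    fix s assume "s \<in> ?R"
    then show "free_prob T {s} \<le> density rho K T + err q K T 1 / n"
      using free_prob_approx[of "{s}" T] by (simp add: abs_le_iff)
  qed (use assms in auto)
  finally have up: "rexp T g \<le> (density rho K T + err q K T 1 / n) * (n choose r)
      + real K * (\<Sum>l\<in>L. 2 ^ 2 ^ cap l * real T ^ l * (real n ^ r / n))"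
    by (simp add: card_nsets finV mult.commute)
  have "(\<Sum>s\<in>?R. unc {s} S) = card (?R - shadow S)"
  proof -
    have "(\<Sum>s\<in>?R. unc {s} S) = (\<Sum>s\<in>?R. of_bool (s \<in> - shadow S))"
      by (intro sum.cong refl) (simp add: unc_def)
    also have "\<dots> = card (?R \<inter> - shadow S)" using fR by (simp add: Collect_neg_eq)
    finally show ?thesis by (simp add: Diff_eq)
  qed
  also have "card (?R - shadow S) = (n choose r) - card S * K"
    using card_shadow[OF S(1)] fR finite_subset
    by (subst card_Diff_subset) (auto simp: card_nsets finV)
  also have "real \<dots> = real (n choose r) - real (card S) * K"
  proof -
    have "card S * K \<le> n choose r"
      using card_shadow[OF S(1)] card_mono[OF fR, of "shadow S"] by (simp add: card_nsets finV)
    then show ?thesis by (simp add: of_nat_diff)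
  qed
  finally have 1: "(\<Sum>s\<in>?R. unc {s} S) = real (n choose r) - real (card S) * K" .
  have 2: "(\<Sum>E\<in>dense_fams l. of_bool (E \<subseteq> S)) = real (card {E \<in> dense_fams l. E \<subseteq> S})" for l
    using finite_dense_fams[of l] by (simp add: Int_def)
  have "g S = real (n choose r) - real (card S) * K
      + real K * (\<Sum>l\<in>L. real (card {E \<in> dense_fams l. E \<subseteq> S}))"
    unfolding g_def 1 2 by simp
  then show ?thesis using S up by (intro exI[of _ S]) auto
qed

text \<open>Delete one block from each dense family.\<close>
lemma ex_sparse_packing:
  assumes "packing S" "finite L"
  shows "\<exists>S'. packing S' \<and> (\<forall>l\<in>L. l \<noteq> 0 \<longrightarrow> (\<forall>E\<in>dense_fams l. \<not> E \<subseteq> S')) \<and>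
    card S \<le> card S' + (\<Sum>l\<in>L. card {E \<in> dense_fams l. E \<subseteq> S})"
proof -
  define D where "D = (\<Union>l\<in>L. {E \<in> dense_fams l. E \<subseteq> S})"
  define pick where "pick E = (SOME e. e \<in> E)" for E :: "'a set set"
  define S' where "S' = S - pick ` D"
  have fD: "finite D" using assms(2) finite_dense_fams by (auto simp: D_def)
  have "card D \<le> (\<Sum>l\<in>L. card {E \<in> dense_fams l. E \<subseteq> S})"
    unfolding D_def by (rule card_UN_le[OF assms(2)])
  moreover have "card (pick ` D) \<le> card D" using fD by (rule card_image_le)
  moreover have "card S - card (pick ` D) \<le> card S'"
    unfolding S'_def using fD by (intro diff_card_le_card_Diff) auto
  ultimately have "card S \<le> card S' + (\<Sum>l\<in>L. card {E \<in> dense_fams l. E \<subseteq> S})" by linarith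
  moreover have "packing S'" using assms(1) by (rule packing_subset) (auto simp: S'_def)
  moreover have "\<not> E \<subseteq> S'" if E: "l \<in> L" "l \<noteq> 0" "E \<in> dense_fams l" for l E
  proof
    assume sub: "E \<subseteq> S'"
    then have "E \<in> D" using E by (auto simp: D_def S'_def)
    moreover have "E \<noteq> {}" using E by (auto simp: dense_fams_def)
    then have "pick E \<in> E" unfolding pick_def by (simp add: some_in_eq)
    ultimately show False using sub by (auto simp: S'_def)
  qed
  ultimately show ?thesis by blast
qed

lemma partial_Steiner_system_packing:
  assumes "packing S" "2 \<le> r"
  shows "partial_Steiner_system n q r V S"
proof -
  have "\<exists>\<^sub>\<le>\<^sub>1 e. e \<in> S \<and> T \<subseteq> e" if "T \<in> nsets V r" for T
    using packingD[OF assms(1)] rsetD[OF that] by (intro Uniq_I) auto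
  then show ?thesis using assms r_less n_ge finV
    by (simp add: partial_Steiner_system_def packing_def)
qed

lemma weakly_sparse_packing:
  assumes S: "packing S" and D: "\<And>l E. l \<in> {1..k} \<Longrightarrow> E \<in> dense_fams l \<Longrightarrow> \<not> E \<subseteq> S"
  shows "weakly_sparse k q r V S"
  unfolding weakly_sparse_def
proof (intro notI, elim exE conjE)
  fix j l P C
  assume j: "q + 1 \<le> j" and l: "int l = kappa q r j + 2" and lk: "l \<le> k"
    and C: "C \<subseteq> S" "configuration q r j l P C"
  have d: "0 < real q - real r" using r_less by simp
  have "1 \<le> kappa q r j"
    unfolding kappa_def le_floor_iff using j d by (simp add: le_divide_eq)
  then have l3: "3 \<le> l" using l by linarith
  \<comment> \<open>The definition of \<open>kappa\<close> and the equation \<open>l = kappa q r j + 2\<close> give \<open>j \<le> cap l\<close>.\<close>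
  have "real_of_int (kappa q r j) = real l - 2" using l by linarith
  moreover have "(real j - real r - 1) / (real q - real r) < real_of_int (kappa q r j) + 1"
    unfolding kappa_def by linarith
  ultimately have "(real j - real r - 1) / (real q - real r) < real l - 1" by simp
  then have "real j - real r - 1 < (real l - 1) * (real q - real r)"
    using d by (simp add: divide_less_eq)
  also have "\<dots> = real ((l - 1) * (q - r))" using l3 r_less by (simp add: of_nat_diff)
  finally have "j \<le> cap l" unfolding cap_def by linarith
  moreover have "card (\<Union>C) \<le> j"
  proof -
    have "finite P" "card P = j" "C \<subseteq> nsets P q" using C(2) by (auto simp: configuration_def)
    moreover from this have "\<Union>C \<subseteq> P" by (auto simp: nsets_def)
    ultimately show ?thesis using card_mono by blast
  qed
  ultimately have "C \<in> dense_fams l"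
    using C S unfolding dense_fams_def configuration_def packing_def by auto
  then show False using D[of l C] l3 lk C(1) by simp
qed

end

theorem theorem7p5:
  fixes \<gamma> :: real and k q r :: nat
  assumes "0 < \<gamma>" and "\<gamma> \<le> 1" and "2 \<le> r" and "r < q"
  shows "\<exists>n0::nat. \<forall>n\<ge>n0. \<exists>(V :: nat set) (S :: nat set set).
           partial_Steiner_system n q r V S \<and>
           weakly_sparse k q r V S \<and>
           real (card S) \<ge> (1 - \<gamma>) * (real (n choose r) / real (q choose r))"
proof -
  define K where "K = q choose r"
  define \<rho>0 where "\<rho>0 = (1 / (2 * real (q - r))) ^ (q - r) * exp (- 2 * real K)"
  have K: "1 \<le> K" using assms by (simp add: K_def Suc_leI)
  have \<rho>0: "0 < \<rho>0" using assms by (simp add: \<rho>0_def)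
  obtain T where T: "\<And>\<rho>. \<rho>0 \<le> \<rho> \<Longrightarrow> \<rho> \<le> 1 \<Longrightarrow> density \<rho> K T \<le> \<gamma> / 2"
    using density_decreases_below[OF \<rho>0, of "\<gamma> / 2" K] assms K by auto
  define mx where "mx l = (l - 1) * (q - r) + r" for l
  define c where "c = err q K T 1 + real K * (\<Sum>l\<in>{1..k}. 2 ^ 2 ^ mx l * real T ^ l) * real r ^ r"
  obtain n1 :: nat where n1: "2 * c / \<gamma> < n1" using reals_Archimedean2 by blast
  define n0 where "n0 = n1 + 2 * q + mx k"
  show ?thesis
  proof (intro exI[of _ n0] allI impI)
    fix n assume n: "n0 \<le> n"
    have rn: "r \<le> n" using n assms by (simp add: n0_def)
    interpret G: greedy_rounds "{..<n}" q r
      by standard (use assms n in \<open>auto simp: n0_def\<close>)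
    have cap: "G.cap l = mx l" for l by (simp add: G.cap_def mx_def)
    have Lcap: "1 \<le> l \<and> G.cap l \<le> card {..<n}" if "l \<in> {1..k}" for l
    proof -
      have "mx l \<le> mx k" using that by (auto simp: mx_def)
      then show ?thesis using that n by (simp add: cap n0_def)
    qed
    obtain S where S: "G.packing S" and Sb: "real (n choose r) - real (card S) * K
        + real K * (\<Sum>l\<in>{1..k}. real (card {E \<in> G.dense_fams l. E \<subseteq> S}))
        \<le> (density G.rho K T + err q K T 1 / n) * (n choose r)
          + real K * (\<Sum>l\<in>{1..k}. 2 ^ 2 ^ mx l * real T ^ l * (real n ^ r / n))"
      using G.ex_good_packing[OF Lcap, of "{1..k}" T] by (auto simp: K_def cap)
    obtain S' where S': "G.packing S'" "\<And>l E. l \<in> {1..k} \<Longrightarrow> E \<in> G.dense_fams l \<Longrightarrow> \<not> E \<subseteq> S'"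
      and cS: "card S \<le> card S' + (\<Sum>l\<in>{1..k}. card {E \<in> G.dense_fams l. E \<subseteq> S})"
      using G.ex_sparse_packing[OF S, of "{1..k}"] by fastforce
    let ?N = "real (n choose r)"
    have n0': "0 < real n" using n assms by (simp add: n0_def)
    have "density G.rho K T \<le> \<gamma> / 2"
      using G.rho_lower_bound G.rho_bounds by (intro T) (auto simp: \<rho>0_def K_def)
    have "(real n / r) ^ r \<le> ?N" using rn by (rule binomial_ge_n_over_k_pow_k)
    then have "real n ^ r \<le> real r ^ r * ?N"
      using assms by (simp add: power_divide field_simps)
    then have nr: "real n ^ r / n \<le> real r ^ r * ?N / n" by (rule divide_right_mono) simp
    have "K * (\<Sum>l\<in>{1..k}. 2 ^ 2 ^ mx l * real T ^ l * (real n ^ r / n))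
        = K * (\<Sum>l\<in>{1..k}. 2 ^ 2 ^ mx l * real T ^ l) * (real n ^ r / n)"
      by (simp only: sum_distrib_right mult.assoc)
    also have "\<dots> \<le> K * (\<Sum>l\<in>{1..k}. 2 ^ 2 ^ mx l * real T ^ l) * (real r ^ r * ?N / n)"
      using nr by (intro mult_left_mono mult_nonneg_nonneg sum_nonneg) auto
    finally have "K * (\<Sum>l\<in>{1..k}. 2 ^ 2 ^ mx l * real T ^ l * (real n ^ r / n))
        \<le> K * (\<Sum>l\<in>{1..k}. 2 ^ 2 ^ mx l * real T ^ l) * (real r ^ r * ?N / n)" .
    moreover have "(density G.rho K T + err q K T 1 / n) * ?N \<le> (\<gamma> / 2 + err q K T 1 / n) * ?N"
      using \<open>density G.rho K T \<le> \<gamma> / 2\<close> by (intro mult_right_mono) auto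
    moreover have "(\<gamma> / 2 + err q K T 1 / n) * ?N
        + real K * (\<Sum>l\<in>{1..k}. 2 ^ 2 ^ mx l * real T ^ l) * (real r ^ r * ?N / n)
        = (\<gamma> / 2 + c / n) * ?N"
      by (simp add: c_def add_divide_distrib algebra_simps)
    ultimately have "real (n choose r) - real (card S) * K
        + real K * (\<Sum>l\<in>{1..k}. real (card {E \<in> G.dense_fams l. E \<subseteq> S})) \<le> (\<gamma> / 2 + c / n) * ?N"
      using Sb by linarith
    also have "\<dots> \<le> \<gamma> * ?N"
    proof (rule mult_right_mono)
      have "2 * c / \<gamma> < n" using n1 n by (simp add: n0_def)
      then have "c / n \<le> \<gamma> / 2" using assms n0' by (simp add: field_simps)
      then show "\<gamma> / 2 + c / n \<le> \<gamma>" by linarith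
    qed simp
    finally have "(1 - \<gamma>) * ?N \<le> (real (card S) - (\<Sum>l\<in>{1..k}. real (card {E \<in> G.dense_fams l. E \<subseteq> S}))) * K"
      by (simp add: algebra_simps)
    also have "\<dots> \<le> real (card S') * K"
    proof (rule mult_right_mono)
      have "real (card S) \<le> real (card S' + (\<Sum>l\<in>{1..k}. card {E \<in> G.dense_fams l. E \<subseteq> S}))"
        using cS by (simp only: of_nat_le_iff)
      then show "real (card S) - (\<Sum>l\<in>{1..k}. real (card {E \<in> G.dense_fams l. E \<subseteq> S})) \<le> real (card S')"
        by simp
    qed simp
    finally have "(1 - \<gamma>) * (?N / K) \<le> real (card S')"
      using K by (simp add: field_simps)
    moreover have "partial_Steiner_system n q r {..<n} S'"
      using G.partial_Steiner_system_packing[OF S'(1) assms(3)] by simp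
    moreover have "weakly_sparse k q r {..<n} S'"
      by (rule G.weakly_sparse_packing[OF S'(1)]) (rule S'(2))
    ultimately show "\<exists>(V :: nat set) (S :: nat set set).
           partial_Steiner_system n q r V S \<and>
           weakly_sparse k q r V S \<and>
           real (card S) \<ge> (1 - \<gamma>) * (real (n choose r) / real (q choose r))"
      unfolding K_def by blast
  qed
qed

end
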